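(* Let $\{\mathcal{A}_i:i<\omega\}$ and $\{\mathcal{B}_i:i<\omega\}$ be two uniformly computable collections of computable structures such that $\mathcal{A}_i\cong\mathcal{B}_i$ for each $i$. Then there exists a structure with two computable copies $\mathcal{M}\cong\mathcal{N}$ such that $\mathrm{IsoSpec}(\mathcal{M},\mathcal{N})=\bigcup_{i<\omega}\mathrm{IsoSpec}(\mathcal{A}_i,\mathcal{B}_i)$.
   Context: A collection $\{\mathcal{A}_x:x\in I\}$ ($I$ computable) of computable structures is uniformly computable if each $\mathcal{A}_x$ is a computable $\mathcal{L}_x$-structure, the languages $\{\mathcal{L}_x\}$ are uniformly computable, and there is a computable function $f$ such that $\varphi_{f(x)}$ is the atomic diagram of $\mathcal{A}_x$ for each $x$. For computable structures $\mathcal{A}\cong\mathcal{B}$, $\mathrm{IsoSpec}(\mathcal{A},\mathcal{B})$ is the set of Turing degrees computing some isomorphism $\mathcal{A}\cong\mathcal{B}$. *)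

theory Defs
  imports Main "HOL-Library.Nat_Bijection"
begin

section \<open>Relative computability\<close>

text \<open>
  Programs for the partial recursive functions relative to an oracle.  All functions are unary;
  several arguments are passed through the pairing bijection \<^const>\<open>prod_encode\<close>.
\<close>

datatype prog =
    PZero | PSucc | PFst | PSnd | POracle
  | PPair prog prog
  | PComp prog prog
  | PPrec prog prog
  | PMu prog

primrec eval :: "nat set \<Rightarrow> prog \<Rightarrow> nat \<Rightarrow> nat option" where
  "eval X PZero n = Some 0"
| "eval X PSucc n = Some (Suc n)"
| "eval X PFst n = Some (fst (prod_decode n))"
| "eval X PSnd n = Some (snd (prod_decode n))"
| "eval X POracle n = Some (of_bool (n \<in> X))"
| "eval X (PPair p q) n =
     Option.bind (eval X p n) (\<lambda>a. Option.bind (eval X q n) (\<lambda>b. Some (prod_encode (a, b))))"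
| "eval X (PComp p q) n = Option.bind (eval X q n) (eval X p)"
| "eval X (PPrec p q) n =
     (let (a, m) = prod_decode n in
        rec_nat (eval X p a)
          (\<lambda>k r. Option.bind r (\<lambda>v. eval X q (prod_encode (a, prod_encode (k, v))))) m)"
| "eval X (PMu p) n =
     (let g = (\<lambda>k. eval X p (prod_encode (n, k))) in
        if \<exists>k. g k = Some 0 \<and> (\<forall>j<k. g j \<noteq> None)
        then Some (LEAST k. g k = Some 0) else None)"

text \<open>A Goedel numbering of the programs; it is onto, so every number is an index.\<close>

primrec prog_encode :: "prog \<Rightarrow> nat" where
  "prog_encode PZero = 0"
| "prog_encode PSucc = 1"
| "prog_encode PFst = 2"
| "prog_encode PSnd = 3"
| "prog_encode POracle = 4"
| "prog_encode (PPair p q) = 4 * prod_encode (prog_encode p, prog_encode q) + 5"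
| "prog_encode (PComp p q) = 4 * prod_encode (prog_encode p, prog_encode q) + 6"
| "prog_encode (PPrec p q) = 4 * prod_encode (prog_encode p, prog_encode q) + 7"
| "prog_encode (PMu p) = 4 * prog_encode p + 8"

lemma inj_prog_encode: "inj prog_encode"
proof (rule injI)
  fix p q show "prog_encode p = prog_encode q \<Longrightarrow> p = q"
  proof (induction p arbitrary: q)
    case (PPair p1 p2) then show ?case by (cases q) (auto, presburger+)
  next
    case (PComp p1 p2) then show ?case by (cases q) (auto, presburger+)
  next
    case (PPrec p1 p2) then show ?case by (cases q) (auto, presburger+)
  next
    case (PMu p) then show ?case by (cases q) (auto, presburger+)
  qed (case_tac q; auto)+
qed

lemma surj_prog_encode: "\<exists>p. prog_encode p = n"
proof (induction n rule: less_induct)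
  case (less n)
  show ?case
  proof (cases "n < 5")
    case True
    then have "n = 0 \<or> n = 1 \<or> n = 2 \<or> n = 3 \<or> n = 4" by auto
    then show ?thesis by (metis prog_encode.simps(1-5))
  next
    case False
    define m where "m = (n - 5) div 4"
    obtain a b where ab: "m = prod_encode (a, b)" by (metis prod_decode_inverse surj_pair)
    have "m < n" using False unfolding m_def by linarith
    moreover have "a \<le> m" "b \<le> m" using ab le_prod_encode_1 le_prod_encode_2 by auto
    ultimately obtain p q r where
      pq: "prog_encode p = a" "prog_encode q = b" "prog_encode r = m"
      using less by (meson le_less_trans)
    have "n = 4 * m + 5 \<or> n = 4 * m + 6 \<or> n = 4 * m + 7 \<or> n = 4 * m + 8"
      using False unfolding m_def by presburger
    then show ?thesis
      by (metis pq ab prog_encode.simps(6-9))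
  qed
qed

lemma bij_prog_encode: "bij prog_encode"
  by (metis bijI inj_prog_encode surj_def surj_prog_encode)

definition prog_decode :: "nat \<Rightarrow> prog" where
  "prog_decode = inv prog_encode"

lemma prog_decode_encode [simp]: "prog_decode (prog_encode p) = p"
  by (simp add: prog_decode_def inj_prog_encode)

lemma prog_encode_decode [simp]: "prog_encode (prog_decode n) = n"
  by (simp add: prog_decode_def bij_prog_encode bij_is_surj surj_f_inv_f)

definition phi_oracle :: "nat set \<Rightarrow> nat \<Rightarrow> nat \<Rightarrow> nat option" where
  "phi_oracle X e = eval X (prog_decode e)"

definition phi :: "nat \<Rightarrow> nat \<Rightarrow> nat option" where
  "phi = phi_oracle {}"

definition computable_fun :: "(nat \<Rightarrow> nat) \<Rightarrow> bool" where
  "computable_fun f \<longleftrightarrow> (\<exists>e. phi e = (\<lambda>n. Some (f n)))"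

definition decides :: "(nat \<Rightarrow> nat option) \<Rightarrow> nat set \<Rightarrow> bool" where
  "decides g S \<longleftrightarrow> g = (\<lambda>n. Some (of_bool (n \<in> S)))"

definition computable_set :: "nat set \<Rightarrow> bool" where
  "computable_set S \<longleftrightarrow> (\<exists>e. decides (phi e) S)"

definition turing_le :: "nat set \<Rightarrow> nat set \<Rightarrow> bool" where
  "turing_le S X \<longleftrightarrow> (\<exists>e. decides (phi_oracle X e) S)"

definition turing_equiv :: "nat set rel" where
  "turing_equiv = {(S, X). turing_le S X \<and> turing_le X S}"

definition turing_degrees :: "nat set set set" where
  "turing_degrees = UNIV // turing_equiv"

primrec subst_oracle :: "prog \<Rightarrow> prog \<Rightarrow> prog" where
  "subst_oracle r PZero = PZero"
| "subst_oracle r PSucc = PSucc"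
| "subst_oracle r PFst = PFst"
| "subst_oracle r PSnd = PSnd"
| "subst_oracle r POracle = r"
| "subst_oracle r (PPair p q) = PPair (subst_oracle r p) (subst_oracle r q)"
| "subst_oracle r (PComp p q) = PComp (subst_oracle r p) (subst_oracle r q)"
| "subst_oracle r (PPrec p q) = PPrec (subst_oracle r p) (subst_oracle r q)"
| "subst_oracle r (PMu p) = PMu (subst_oracle r p)"

lemma eval_subst_oracle:
  assumes "decides (eval X r) S"
  shows "eval X (subst_oracle r p) = eval S p"
  by (induction p; rule ext) (use assms in \<open>simp_all add: decides_def\<close>)

lemma turing_le_iff: "turing_le S X \<longleftrightarrow> (\<exists>p. decides (eval X p) S)"
  by (metis phi_oracle_def prog_decode_encode turing_le_def)

lemma turing_le_refl: "turing_le S S"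
  by (auto simp: turing_le_iff decides_def fun_eq_iff intro: exI[of _ POracle])

lemma turing_le_trans: "turing_le S T \<Longrightarrow> turing_le T X \<Longrightarrow> turing_le S X"
  by (metis turing_le_iff eval_subst_oracle)

lemma equiv_turing_equiv: "equiv UNIV turing_equiv"
  by (intro equivI refl_onI symI transI)
     (auto simp: turing_equiv_def turing_le_refl intro: turing_le_trans)


section \<open>Languages, structures and atomic diagrams\<close>

text \<open>Symbols are natural numbers; a language tells which numbers are symbols, and of which sort
  and arity.  Constants are function symbols of arity 0.\<close>

datatype sym_sort = RelSym nat | FunSym nat

type_synonym language = "nat \<Rightarrow> sym_sort option"

fun sort_encode :: "sym_sort option \<Rightarrow> nat" where
  "sort_encode None = 0"
| "sort_encode (Some (RelSym k)) = 2 * k + 1"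
| "sort_encode (Some (FunSym k)) = 2 * k + 2"

text \<open>The interpretations are only relevant for symbols of the language and on tuples of the right
  length from the universe.\<close>

record struc =
  universe :: "nat set"
  rel_of :: "nat \<Rightarrow> nat list \<Rightarrow> bool"
  fun_of :: "nat \<Rightarrow> nat list \<Rightarrow> nat"

definition is_struc :: "language \<Rightarrow> struc \<Rightarrow> bool" where
  "is_struc L A \<longleftrightarrow> universe A \<noteq> {} \<and>
     (\<forall>s xs. L s = Some (FunSym (length xs)) \<and> set xs \<subseteq> universe A
        \<longrightarrow> fun_of A s xs \<in> universe A)"

text \<open>Closed terms and literals of the language expanded by a constant for every element of the
  structure.\<close>

datatype tm = Elem nat | App nat "tm list"

datatype atom = AEq tm tm | ARel nat "tm list"

datatype literal = LPos atom | LNeg atom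

primrec tm_encode :: "tm \<Rightarrow> nat" where
  "tm_encode (Elem a) = 2 * a"
| "tm_encode (App s ts) = 2 * prod_encode (s, list_encode (map tm_encode ts)) + 1"

primrec atom_encode :: "atom \<Rightarrow> nat" where
  "atom_encode (AEq t u) = 2 * prod_encode (tm_encode t, tm_encode u)"
| "atom_encode (ARel s ts) = 2 * prod_encode (s, list_encode (map tm_encode ts)) + 1"

primrec literal_encode :: "literal \<Rightarrow> nat" where
  "literal_encode (LPos a) = 2 * atom_encode a"
| "literal_encode (LNeg a) = 2 * atom_encode a + 1"

primrec wf_tm :: "language \<Rightarrow> struc \<Rightarrow> tm \<Rightarrow> bool" where
  "wf_tm L A (Elem a) \<longleftrightarrow> a \<in> universe A"
| "wf_tm L A (App s ts) \<longleftrightarrow> L s = Some (FunSym (length ts)) \<and> list_all (wf_tm L A) ts"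

primrec wf_atom :: "language \<Rightarrow> struc \<Rightarrow> atom \<Rightarrow> bool" where
  "wf_atom L A (AEq t u) \<longleftrightarrow> wf_tm L A t \<and> wf_tm L A u"
| "wf_atom L A (ARel s ts) \<longleftrightarrow> L s = Some (RelSym (length ts)) \<and> list_all (wf_tm L A) ts"

primrec tm_value :: "struc \<Rightarrow> tm \<Rightarrow> nat" where
  "tm_value A (Elem a) = a"
| "tm_value A (App s ts) = fun_of A s (map (tm_value A) ts)"

primrec atom_true :: "struc \<Rightarrow> atom \<Rightarrow> bool" where
  "atom_true A (AEq t u) \<longleftrightarrow> tm_value A t = tm_value A u"
| "atom_true A (ARel s ts) \<longleftrightarrow> rel_of A s (map (tm_value A) ts)"

definition atomic_diagram :: "language \<Rightarrow> struc \<Rightarrow> nat set" where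
  "atomic_diagram L A =
     {literal_encode (LPos a) | a. wf_atom L A a \<and> atom_true A a} \<union>
     {literal_encode (LNeg a) | a. wf_atom L A a \<and> \<not> atom_true A a}"


section \<open>Computable structures and isomorphism spectra\<close>

definition computable_language :: "language \<Rightarrow> bool" where
  "computable_language L \<longleftrightarrow> computable_fun (\<lambda>s. sort_encode (L s))"

text \<open>The universe of a computable structure is a computable set: \<open>a\<close> belongs to it iff the
  sentence \<open>a = a\<close> belongs to the diagram.\<close>

definition computable_struc :: "language \<Rightarrow> struc \<Rightarrow> bool" where
  "computable_struc L A \<longleftrightarrow>
     computable_language L \<and> is_struc L A \<and> computable_set (atomic_diagram L A)"

definition uniformly_computable_languages :: "nat set \<Rightarrow> (nat \<Rightarrow> language) \<Rightarrow> bool" where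
  "uniformly_computable_languages I L \<longleftrightarrow>
     (\<exists>g. computable_fun g \<and> (\<forall>x\<in>I. phi (g x) = (\<lambda>s. Some (sort_encode (L x s)))))"

definition uniformly_computable ::
  "nat set \<Rightarrow> (nat \<Rightarrow> language) \<Rightarrow> (nat \<Rightarrow> struc) \<Rightarrow> bool" where
  "uniformly_computable I L A \<longleftrightarrow>
     computable_set I \<and>
     (\<forall>x\<in>I. computable_struc (L x) (A x)) \<and>
     uniformly_computable_languages I L \<and>
     (\<exists>f. computable_fun f \<and> (\<forall>x\<in>I. decides (phi (f x)) (atomic_diagram (L x) (A x))))"

text \<open>Only the values of \<open>h\<close> on the universe of \<open>A\<close> matter.\<close>

definition is_iso :: "language \<Rightarrow> struc \<Rightarrow> struc \<Rightarrow> (nat \<Rightarrow> nat) \<Rightarrow> bool" where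
  "is_iso L A B h \<longleftrightarrow>
     bij_betw h (universe A) (universe B) \<and>
     (\<forall>s xs. L s = Some (RelSym (length xs)) \<and> set xs \<subseteq> universe A
        \<longrightarrow> (rel_of B s (map h xs) \<longleftrightarrow> rel_of A s xs)) \<and>
     (\<forall>s xs. L s = Some (FunSym (length xs)) \<and> set xs \<subseteq> universe A
        \<longrightarrow> fun_of B s (map h xs) = h (fun_of A s xs))"

definition isomorphic :: "language \<Rightarrow> struc \<Rightarrow> struc \<Rightarrow> bool" where
  "isomorphic L A B \<longleftrightarrow> (\<exists>h. is_iso L A B h)"

definition graph_on :: "nat set \<Rightarrow> (nat \<Rightarrow> nat) \<Rightarrow> nat set" where
  "graph_on D h = {prod_encode (a, h a) | a. a \<in> D}"

text \<open>Since the universe of \<open>A\<close> is computable, an oracle computes \<open>h\<close> on it iff it computes the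
  graph of \<open>h\<close>.\<close>

definition IsoSpec :: "language \<Rightarrow> struc \<Rightarrow> struc \<Rightarrow> nat set set set" where
  "IsoSpec L A B =
     {d \<in> turing_degrees. \<exists>h. is_iso L A B h \<and> (\<exists>X\<in>d. turing_le (graph_on (universe A) h) X)}"

end

theory Submission
  imports Defs
begin

text \<open>
  For a finite set \<open>S\<close> let \<open>C S\<close> be the sequence of structures whose \<open>i\<close>-th entry is \<open>B i\<close> if \<open>i\<close> is in
  \<open>S\<close> and \<open>A i\<close> otherwise.  Let \<open>M\<close> be the disjoint union of the \<open>C S\<close> with \<open>S\<close> of even cardinality,
  and \<open>N\<close> that of the \<open>C S\<close> with \<open>S\<close> of odd cardinality.  An isomorphism \<open>h\<close> from \<open>A i\<close> to \<open>B i\<close> yields one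
  from \<open>M\<close> to \<open>N\<close> that sends \<open>C S\<close> to \<open>C T\<close>, where \<open>T\<close> is the symmetric difference of \<open>S\<close> and \<open>{i}\<close>: it is
  \<open>h\<close> or its inverse on the \<open>i\<close>-th entry and the identity on the others, hence computable from \<open>h\<close>.
  Conversely, an isomorphism from \<open>M\<close> to \<open>N\<close> sends \<open>C {}\<close> to some \<open>C S\<close> with \<open>S\<close> of odd cardinality, and
  its restriction to an entry \<open>i\<close> in \<open>S\<close> is an isomorphism from \<open>A i\<close> to \<open>B i\<close>.  That \<open>M\<close> and \<open>N\<close>
  are computable uses a universal machine to decide the diagrams uniformly in \<open>i\<close>.
\<close>

section \<open>Closure properties of the computable functions\<close>

abbreviation pfst :: "nat \<Rightarrow> nat" where "pfst n \<equiv> fst (prod_decode n)"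
abbreviation psnd :: "nat \<Rightarrow> nat" where "psnd n \<equiv> snd (prod_decode n)"

text \<open>Only total functions occur, so composition and recursion need no side conditions on
  definedness; programs replace indices, which \<open>ex_phi_oracle_iff\<close> justifies.\<close>

definition computes :: "nat set \<Rightarrow> (nat \<Rightarrow> nat) \<Rightarrow> bool" where
  "computes X f \<longleftrightarrow> (\<exists>p. eval X p = (\<lambda>n. Some (f n)))"

abbreviation computes_pred :: "nat set \<Rightarrow> (nat \<Rightarrow> bool) \<Rightarrow> bool" where
  "computes_pred X P \<equiv> computes X (\<lambda>n. of_bool (P n))"

lemma ex_phi_oracle_iff: "(\<exists>e. P (phi_oracle X e)) \<longleftrightarrow> (\<exists>p. P (eval X p))"
  unfolding phi_oracle_def by (metis prog_decode_encode)

lemma computable_fun_iff: "computable_fun f \<longleftrightarrow> computes {} f"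
  unfolding computable_fun_def computes_def phi_def by (rule ex_phi_oracle_iff)

lemma computable_set_iff: "computable_set S \<longleftrightarrow> computes_pred {} (\<lambda>n. n \<in> S)"
  unfolding computable_set_def computes_def decides_def phi_def by (rule ex_phi_oracle_iff)

lemma turing_le_iff_computes: "turing_le S X \<longleftrightarrow> computes_pred X (\<lambda>n. n \<in> S)"
  by (simp add: turing_le_iff computes_def decides_def)

text \<open>\<open>PZero\<close> decides the empty set, so putting it in place of the oracle queries
  simulates the empty oracle under any \<open>X\<close>.\<close>

lemma computes_oracle_free:
  assumes "computes {} f" shows "computes X f"
proof -
  have "decides (eval X PZero) {}" by (simp add: decides_def fun_eq_iff)
  then have "eval X (subst_oracle PZero p) = eval {} p" for p by (rule eval_subst_oracle)
  then show ?thesis using assms unfolding computes_def by metis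
qed

lemma computes_compose:
  assumes "computes X f" "computes X g" shows "computes X (\<lambda>n. f (g n))"
proof -
  obtain p q where "eval X p = (\<lambda>n. Some (f n))" "eval X q = (\<lambda>n. Some (g n))"
    using assms by (auto simp: computes_def)
  then have "eval X (PComp p q) = (\<lambda>n. Some (f (g n)))" by auto
  then show ?thesis by (auto simp: computes_def)
qed

lemma computes_pair:
  assumes "computes X f" "computes X g" shows "computes X (\<lambda>n. prod_encode (f n, g n))"
proof -
  obtain p q where "eval X p = (\<lambda>n. Some (f n))" "eval X q = (\<lambda>n. Some (g n))"
    using assms by (auto simp: computes_def)
  then have "eval X (PPair p q) = (\<lambda>n. Some (prod_encode (f n, g n)))" by auto
  then show ?thesis by (auto simp: computes_def)
qed

lemma computes_id: "computes X (\<lambda>n. n)"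
proof -
  have "eval X (PPair PFst PSnd) = (\<lambda>n. Some n)" by (simp add: fun_eq_iff)
  then show ?thesis by (auto simp: computes_def)
qed

lemma computes_Suc: "computes X f \<Longrightarrow> computes X (\<lambda>n. Suc (f n))"
  by (rule computes_compose[of X Suc]) (auto simp: computes_def intro!: exI[of _ PSucc])

lemma computes_fst: "computes X f \<Longrightarrow> computes X (\<lambda>n. pfst (f n))"
  by (rule computes_compose[of X "\<lambda>n. pfst n"]) (auto simp: computes_def intro!: exI[of _ PFst])

lemma computes_snd: "computes X f \<Longrightarrow> computes X (\<lambda>n. psnd (f n))"
  by (rule computes_compose[of X "\<lambda>n. psnd n"]) (auto simp: computes_def intro!: exI[of _ PSnd])

lemma computes_const: "computes X (\<lambda>n. c)"
proof (induction c)
  case 0 show ?case by (auto simp: computes_def intro!: exI[of _ PZero])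
next
  case (Suc c) then show ?case by (rule computes_Suc)
qed

text \<open>A curried function is represented by its unary version on pairs. The rule supplies the
  arguments when \<open>F\<close> is a variable, as in the bodies of recursions and folds.\<close>

lemma computes_compose2:
  assumes "computes X (\<lambda>z. F (pfst z) (psnd z))" "computes X f" "computes X g"
  shows "computes X (\<lambda>n. F (f n) (g n))"
  using computes_compose[OF assms(1) computes_pair[OF assms(2,3)]] by simp

lemma computes_compose3:
  assumes "computes X (\<lambda>z. F (pfst z) (pfst (psnd z)) (psnd (psnd z)))"
    and "computes X f" "computes X g" "computes X h"
  shows "computes X (\<lambda>n. F (f n) (g n) (h n))"
  using computes_compose[OF assms(1) computes_pair[OF assms(2) computes_pair[OF assms(3,4)]]]
  by simp

text \<open>\<open>PPrec\<close> keeps its parameter throughout, so \<open>f\<close> and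
  \<open>g\<close> may depend on \<open>n\<close>; composing with the pair of \<open>n\<close> and
  \<open>m n\<close> sets the number of rounds.\<close>

lemma computes_rec:
  assumes "computes X f"
    and "computes X (\<lambda>z. g (pfst z) (pfst (psnd z)) (psnd (psnd z)))"
    and "computes X m"
  shows "computes X (\<lambda>n. rec_nat (f n) (\<lambda>k r. g n k r) (m n))"
proof -
  obtain p q where p: "eval X p = (\<lambda>n. Some (f n))"
    and q: "eval X q = (\<lambda>z. Some (g (pfst z) (pfst (psnd z)) (psnd (psnd z))))"
    using assms(1,2) by (auto simp: computes_def)
  have "rec_nat (eval X p a) (\<lambda>k r. Option.bind r (\<lambda>v. eval X q (prod_encode (a, prod_encode (k, v))))) m
      = Some (rec_nat (f a) (\<lambda>k r. g a k r) m)" for a m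
    by (induction m) (simp_all add: p q)
  then have "eval X (PPrec p q)
      = (\<lambda>z. Some (rec_nat (f (pfst z)) (\<lambda>k r. g (pfst z) k r) (psnd z)))"
    by (simp add: fun_eq_iff split: prod.split)
  then have *: "computes X (\<lambda>z. rec_nat (f (pfst z)) (\<lambda>k r. g (pfst z) k r) (psnd z))"
    by (auto simp: computes_def)
  show ?thesis
    using computes_compose[OF * computes_pair[OF computes_id assms(3)]] by simp
qed

lemma computes_Least:
  assumes "computes X (\<lambda>z. f (pfst z) (psnd z))" and "\<And>n. \<exists>k. f n k = 0"
  shows "computes X (\<lambda>n. LEAST k. f n k = 0)"
proof -
  obtain p where "eval X p = (\<lambda>z. Some (f (pfst z) (psnd z)))"
    using assms(1) by (auto simp: computes_def)
  then have "eval X (PMu p) = (\<lambda>n. Some (LEAST k. f n k = 0))"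
    using assms(2) by (auto simp: fun_eq_iff Let_def)
  then show ?thesis by (auto simp: computes_def)
qed

section \<open>Arithmetic, comparisons and connectives\<close>

named_theorems computes_intros

lemmas [computes_intros] = computes_Suc computes_fst computes_snd computes_pair computes_id
  computes_const

lemma computes_add [computes_intros]:
  assumes "computes X f" "computes X g" shows "computes X (\<lambda>n. f n + g n)"
proof -
  have "rec_nat a (\<lambda>_ r. Suc r) b = a + b" for a b :: nat by (induction b) auto
  then show ?thesis
    using computes_rec[of X f "\<lambda>_ _ r. Suc r" g] assms by (simp add: computes_intros)
qed

lemma computes_mult [computes_intros]:
  assumes "computes X f" "computes X g" shows "computes X (\<lambda>n. f n * g n)"
proof -
  have "rec_nat 0 (\<lambda>_ r. r + a) b = a * b" for a b :: nat by (induction b) auto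
  then show ?thesis
    using computes_rec[of X "\<lambda>_. 0" "\<lambda>n _ r. r + f n" g] assms
    by (simp add: computes_intros computes_compose[OF assms(1)])
qed

lemma computes_diff [computes_intros]:
  assumes "computes X f" "computes X g" shows "computes X (\<lambda>n. f n - g n)"
proof -
  \<comment> \<open>Predecessor: the recursion returns the index of its last round, and 0 if there
    is none.\<close>
  have pre: "rec_nat 0 (\<lambda>k _. k) b = b - 1" for b :: nat by (induction b) auto
  have P: "computes X h \<Longrightarrow> computes X (\<lambda>n. h n - 1)" for h
    using computes_rec[of X "\<lambda>_. 0" "\<lambda>_ k _. k" h] by (simp add: computes_intros pre)
  have "rec_nat a (\<lambda>_ r. r - 1) b = a - b" for a b :: nat by (induction b) auto
  then show ?thesis
    using computes_rec[of X f "\<lambda>_ _ r. r - 1" g] assms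
    by (simp add: P[unfolded One_nat_def] computes_intros)
qed

lemma computes_not [computes_intros]:
  assumes "computes_pred X P" shows "computes_pred X (\<lambda>n. \<not> P n)"
proof -
  have "of_bool (\<not> b) = 1 - (of_bool b :: nat)" for b by simp
  then show ?thesis using assms by (simp only: computes_intros)
qed

lemma computes_conj [computes_intros]:
  assumes "computes_pred X P" "computes_pred X Q" shows "computes_pred X (\<lambda>n. P n \<and> Q n)"
proof -
  have "of_bool (a \<and> b) = (of_bool a * of_bool b :: nat)" for a b by simp
  then show ?thesis using assms by (simp only: computes_intros)
qed

lemma computes_disj [computes_intros]:
  assumes "computes_pred X P" "computes_pred X Q" shows "computes_pred X (\<lambda>n. P n \<or> Q n)"
  using computes_not[OF computes_conj[OF computes_not[OF assms(1)] computes_not[OF assms(2)]]]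
  by simp

lemma computes_iff [computes_intros]:
  assumes "computes_pred X P" "computes_pred X Q" shows "computes_pred X (\<lambda>n. P n \<longleftrightarrow> Q n)"
proof -
  have "(a \<longleftrightarrow> b) \<longleftrightarrow> (a \<and> b) \<or> (\<not> a \<and> \<not> b)" for a b by blast
  then show ?thesis using assms by (simp only: computes_intros)
qed

lemma computes_le [computes_intros]:
  assumes "computes X f" "computes X g" shows "computes_pred X (\<lambda>n. f n \<le> g n)"
proof -
  have "of_bool (a \<le> b) = 1 - (a - b)" for a b :: nat by simp
  then show ?thesis using assms by (simp only: computes_intros)
qed

lemma computes_eq [computes_intros]:
  assumes "computes X f" "computes X g" shows "computes_pred X (\<lambda>n. f n = g n)"
  unfolding order_eq_iff by (intro computes_intros assms)

lemma computes_if [computes_intros]: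
  assumes "computes_pred X P" "computes X f" "computes X g"
  shows "computes X (\<lambda>n. if P n then f n else g n)"
proof -
  have "(if b then x else y) = of_bool b * x + of_bool (\<not> b) * y" for b and x y :: nat by simp
  then show ?thesis using assms by (simp only: computes_intros)
qed

lemma computes_if_pred [computes_intros]:
  assumes "computes_pred X P" "computes_pred X Q" "computes_pred X R"
  shows "computes_pred X (\<lambda>n. if P n then Q n else R n)"
proof -
  have "(if b then x else y) \<longleftrightarrow> (b \<and> x) \<or> (\<not> b \<and> y)" for b and x y :: bool by simp
  then show ?thesis using assms by (simp only: computes_intros)
qed

lemma computes_mod [computes_intros]:
  assumes "computes X f" "computes X g" shows "computes X (\<lambda>n. f n mod g n)"
proof -
  \<comment> \<open>A counter that wraps at \<open>d\<close>; for \<open>d = 0\<close> it never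
    wraps, in accordance with \<open>b mod 0 = b\<close>.\<close>
  have "rec_nat 0 (\<lambda>_ r. if Suc r = d then 0 else Suc r) b = b mod d" for b d :: nat
    by (induction b) (auto simp: mod_Suc)
  then show ?thesis
    using computes_rec[of X "\<lambda>_. 0" "\<lambda>n _ r. if Suc r = g n then 0 else Suc r" f] assms
    by (simp add: computes_intros computes_compose[OF assms(2)])
qed

lemma computes_div [computes_intros]:
  assumes "computes X f" "computes X g" shows "computes X (\<lambda>n. f n div g n)"
proof -
  have "rec_nat 0 (\<lambda>k r. if Suc k mod d = 0 then Suc r else r) b = b div d" if "d \<noteq> 0" for b d :: nat
    using that by (induction b) (auto simp: div_Suc)
  then have "(if d = 0 then 0 else rec_nat 0 (\<lambda>k r. if Suc k mod d = 0 then Suc r else r) b) = b div d"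
    for b d :: nat by auto
  moreover have "computes X (\<lambda>n. if g n = 0 then 0
      else rec_nat 0 (\<lambda>k r. if Suc k mod g n = 0 then Suc r else r) (f n))"
    by (intro computes_intros computes_rec computes_compose[OF assms(2)] assms(1))
  ultimately show ?thesis by simp
qed

lemma computes_power [computes_intros]:
  assumes "computes X f" "computes X g" shows "computes X (\<lambda>n. f n ^ g n)"
proof -
  have "rec_nat 1 (\<lambda>_ r. a * r) b = a ^ b" for a b :: nat by (induction b) auto
  moreover have "computes X (\<lambda>n. rec_nat 1 (\<lambda>_ r. f n * r) (g n))"
    by (intro computes_intros computes_rec computes_compose[OF assms(1)] assms(2))
  ultimately show ?thesis by simp
qed

lemma computes_even [computes_intros]:
  assumes "computes X f" shows "computes_pred X (\<lambda>n. even (f n))"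
  unfolding even_iff_mod_2_eq_zero by (intro computes_intros assms)

lemma computes_sum [computes_intros]:
  assumes "computes X (\<lambda>z. F (pfst z) (psnd z))" "computes X f"
  shows "computes X (\<lambda>n. \<Sum>i<f n. F n i)"
proof -
  have "rec_nat 0 (\<lambda>k r. r + F n k) b = (\<Sum>i<b. F n i)" for n b by (induction b) auto
  moreover have "computes X (\<lambda>n. rec_nat 0 (\<lambda>k r. r + F n k) (f n))"
    by (intro computes_intros computes_rec computes_compose2[OF assms(1)] assms(2))
  ultimately show ?thesis by simp
qed

section \<open>Coded finite sets and lists\<close>

lemma set_decode_subset_lessThan: "set_decode s \<subseteq> {..<s}"
proof
  fix i assume "i \<in> set_decode s"
  then have "s div 2 ^ i \<noteq> 0" by (metis even_zero set_decode_def mem_Collect_eq)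
  then have "2 ^ i \<le> s" by (metis div_less leI)
  then show "i \<in> {..<s}" by (meson lessThan_iff less_exp order_less_le_trans)
qed

lemma computes_mem_set_decode [computes_intros]:
  assumes "computes X f" "computes X g" shows "computes_pred X (\<lambda>n. f n \<in> set_decode (g n))"
  unfolding set_decode_def mem_Collect_eq by (intro computes_intros assms)

lemma computes_card_set_decode [computes_intros]:
  assumes "computes X f" shows "computes X (\<lambda>n. card (set_decode (f n)))"
proof -
  \<comment> \<open>Elements of a coded set are smaller than its code, so a sum bounded by the code
    misses none.\<close>
  have "card (set_decode s) = (\<Sum>i<s. of_bool (i \<in> set_decode s))" for s
    using set_decode_subset_lessThan[of s] by (simp add: sum.If_cases of_bool_def Int_absorb1)
  then show ?thesis by (simp only:) (intro computes_intros computes_compose[OF assms])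
qed

text \<open>The state pairs the accumulator with the code of the remaining list. The length of a
  list is at most its code, so \<open>l n\<close> rounds suffice; the surplus ones change
  nothing.\<close>

lemma computes_foldl [computes_intros]:
  assumes "computes X (\<lambda>z. F (pfst z) (pfst (psnd z)) (psnd (psnd z)))" "computes X f" "computes X l"
  shows "computes X (\<lambda>n. foldl (\<lambda>a x. F n a x) (f n) (list_decode (l n)))"
proof -
  define step where "step n z = (if psnd z = 0 then z else
      prod_encode (F n (pfst z) (pfst (psnd z - 1)), psnd (psnd z - 1)))" for n z
  have run: "k \<ge> length xs \<Longrightarrow> rec_nat (prod_encode (a, list_encode xs)) (\<lambda>_. step n) k
      = prod_encode (foldl (F n) a xs, 0)" for n k a xs
  proof (induction xs arbitrary: a k)
    case Nil
    show ?case by (induction k) (simp_all add: step_def)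
  next
    case (Cons x xs)
    then obtain k' where k': "k = Suc k'" by (cases k) auto
    \<comment> \<open>Moves the first round to the front, whereas \<open>rec_nat\<close> unfolds at
      the last one.\<close>
    have "rec_nat z (\<lambda>_. step n) (Suc k) = rec_nat (step n z) (\<lambda>_. step n) k" for z k
      by (induction k) auto
    moreover have "step n (prod_encode (a, list_encode (x # xs))) = prod_encode (F n a x, list_encode xs)"
      by (simp add: step_def)
    ultimately show ?case using Cons.IH[of k' "F n a x"] Cons.prems k'
      by (simp only: foldl.simps length_Cons Suc_le_mono)
  qed
  have len: "length xs \<le> list_encode xs" for xs
  proof (induction xs)
    case (Cons x xs)
    then show ?case using le_prod_encode_2[of "list_encode xs" x] by simp
  qed simp
  have run': "foldl (\<lambda>a x. F n a x) (f n) (list_decode (l n)) =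
     pfst (rec_nat (prod_encode (f n, l n)) (\<lambda>_. step n) (l n))" for n
    using run[of "list_decode (l n)" "l n" "f n" n] len[of "list_decode (l n)"] by simp
  have step: "computes X (\<lambda>z. step (pfst z) (psnd z))"
    unfolding step_def
    by (intro computes_intros computes_compose3[OF assms(1)])
  from run' show ?thesis
    by (simp only:) (intro computes_intros computes_rec computes_compose2[OF step] assms(2,3))
qed

lemma computes_length [computes_intros]:
  assumes "computes X l" shows "computes X (\<lambda>n. length (list_decode (l n)))"
proof -
  have "foldl (\<lambda>a _. Suc a) k xs = k + length xs" for k and xs :: "nat list"
    by (induction xs arbitrary: k) auto
  then show ?thesis
    using computes_foldl[of X "\<lambda>_ a _. Suc a" "\<lambda>_. 0" l] assms by (simp add: computes_intros)
qed

lemma computes_ball [computes_intros]: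
  assumes "computes_pred X (\<lambda>z. P (pfst z) (psnd z))" "computes X l"
  shows "computes_pred X (\<lambda>n. \<forall>x\<in>set (list_decode (l n)). P n x)"
proof -
  have "foldl (\<lambda>a x. a * of_bool (P n x)) k xs = k * of_bool (\<forall>x\<in>set xs. P n x)"
    for n xs and k :: nat by (induction xs arbitrary: k) auto
  moreover have "computes X (\<lambda>n. foldl (\<lambda>a x. a * of_bool (P n x)) 1 (list_decode (l n)))"
    by (intro computes_intros computes_compose2[OF assms(1)] assms(2))
  ultimately show ?thesis by simp
qed

text \<open>A left fold that conses onto its accumulator reverses the list; a second such fold
  restores the order.\<close>

lemma computes_map [computes_intros]:
  assumes "computes X (\<lambda>z. F (pfst z) (psnd z))" "computes X l"
  shows "computes X (\<lambda>n. list_encode (map (\<lambda>x. F n x) (list_decode (l n))))"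
proof -
  have aux: "foldl (\<lambda>a x. Suc (prod_encode (G x, a))) (list_encode ys) xs
      = list_encode (rev (map G xs) @ ys)" for ys xs :: "nat list" and G
    by (induction xs arbitrary: ys) (simp_all flip: list_encode.simps)
  have "computes X (\<lambda>n. foldl (\<lambda>a x. Suc (prod_encode (F n x, a))) 0 (list_decode (l n)))"
    by (intro computes_intros computes_compose2[OF assms(1)] assms(2))
  then have "computes X (\<lambda>n. list_encode (rev (map (F n) (list_decode (l n)))))"
    using aux[where ys = "[]"] by simp
  then have "computes X (\<lambda>n. foldl (\<lambda>a x. Suc (prod_encode (x, a))) 0
      (list_decode (list_encode (rev (map (F n) (list_decode (l n)))))))"
    by (intro computes_intros)
  then show ?thesis using aux[where ys = "[]" and G = "\<lambda>x. x"] by (simp add: rev_map)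
qed


section \<open>A universal machine\<close>

text \<open>
  The machine state is a pair of a value and a stack of frames.  A frame is a pair of a tag and
  data: tag 0 applies a program to the value, 1 and 2 are the continuations after the first and
  the second component of a pair, 3 and 4 those of one round of \<^const>\<open>PPrec\<close> and \<^const>\<open>PMu\<close>.
\<close>

abbreviation push :: "nat \<Rightarrow> nat \<Rightarrow> nat \<Rightarrow> nat" where
  "push t d K \<equiv> Suc (prod_encode (prod_encode (t, d), K))"

text \<open>Inverts \<open>prog_encode\<close>: the codes from 5 on carry the constructor in the
  residue of \<open>e - 5\<close> modulo 4, residue 3 being \<open>PMu\<close>. Oracle queries are
  answered by 0 since only the empty oracle is simulated.\<close>

definition apply_prog :: "nat \<Rightarrow> nat \<Rightarrow> nat \<Rightarrow> nat" where
  "apply_prog e v K = (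
     if e = 0 then prod_encode (0, K)
     else if e = 1 then prod_encode (Suc v, K)
     else if e = 2 then prod_encode (pfst v, K)
     else if e = 3 then prod_encode (psnd v, K)
     else if e = 4 then prod_encode (0, K)
     else let m = (e - 5) div 4; c = (e - 5) mod 4 in
       if c = 0 then prod_encode (v, push 0 (pfst m) (push 1 (prod_encode (psnd m, v)) K))
       else if c = 1 then prod_encode (v, push 0 (psnd m) (push 0 (pfst m) K))
       else if c = 2 then prod_encode (pfst v, push 0 (pfst m)
         (push 3 (prod_encode (psnd m, prod_encode (pfst v, prod_encode (0, psnd v)))) K))
       else prod_encode (prod_encode (v, 0), push 0 m (push 4 (prod_encode (m, prod_encode (v, 0))) K)))"

text \<open>The data \<open>d\<close> keep what the value register loses: the second program and the
  input (tag 1), the first component (2), \<open>q\<close>, \<open>a\<close>, the round and the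
  number of rounds (3), \<open>p\<close>, \<open>n\<close> and the argument being tested
  (4).\<close>

definition resume :: "nat \<Rightarrow> nat \<Rightarrow> nat \<Rightarrow> nat \<Rightarrow> nat" where
  "resume t d v K = (
     if t = 1 then prod_encode (psnd d, push 0 (pfst d) (push 2 v K))
     else if t = 2 then prod_encode (prod_encode (d, v), K)
     else if t = 3 then
       let q = pfst d; a = pfst (psnd d); k = pfst (psnd (psnd d)); m = psnd (psnd (psnd d)) in
       if k = m then prod_encode (v, K)
       else prod_encode (prod_encode (a, prod_encode (k, v)),
         push 0 q (push 3 (prod_encode (q, prod_encode (a, prod_encode (Suc k, m)))) K))
     else
       let p = pfst d; n = pfst (psnd d); k = psnd (psnd d) in
       if v = 0 then prod_encode (k, K)
       else prod_encode (prod_encode (n, Suc k),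
         push 0 p (push 4 (prod_encode (p, prod_encode (n, Suc k))) K)))"

text \<open>The stack 0 is the empty one and means halting. Halted states are fixed points, so extra
  steps do no harm.\<close>

definition machine_step :: "nat \<Rightarrow> nat" where
  "machine_step s = (
     if psnd s = 0 then s
     else let fr = pfst (psnd s - 1); K = psnd (psnd s - 1) in
       if pfst fr = 0 then apply_prog (psnd fr) (pfst s) K
       else resume (pfst fr) (psnd fr) (pfst s) K)"

section \<open>Runs of the machine\<close>

definition reaches :: "nat \<Rightarrow> nat \<Rightarrow> bool" where
  "reaches s s' \<longleftrightarrow> (\<exists>t. (machine_step ^^ t) s = s')"

lemma reaches_refl: "reaches s s"
  unfolding reaches_def by (intro exI[of _ 0]) simp

lemma reaches_step: "reaches (machine_step s) s' \<Longrightarrow> reaches s s'"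
  unfolding reaches_def by (metis funpow_Suc_right comp_apply)

lemma reaches_trans: "reaches s s' \<Longrightarrow> reaches s' s'' \<Longrightarrow> reaches s s''"
  unfolding reaches_def by (metis funpow_add comp_apply)

lemma step_prog: "machine_step (prod_encode (v, push 0 e K)) = apply_prog e v K"
  by (simp add: machine_step_def)

lemma reaches_prog: "reaches (apply_prog e v K) s \<Longrightarrow> reaches (prod_encode (v, push 0 e K)) s"
  by (rule reaches_step) (simp only: step_prog)

lemma step_resume: "t \<noteq> 0 \<Longrightarrow> machine_step (prod_encode (v, push t d K)) = resume t d v K"
  by (simp add: machine_step_def)

lemma div_mod_4:
  "Suc (4 * m) div 4 = m" "Suc (Suc (4 * m)) div 4 = m" "Suc (Suc (Suc (4 * m))) div 4 = m"
  "Suc (4 * m) mod 4 = 1" "Suc (Suc (4 * m)) mod 4 = 2" "Suc (Suc (Suc (4 * m))) mod 4 = 3"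
  by presburger+

lemma apply_prog_simps:
  "apply_prog (prog_encode PZero) v K = prod_encode (0, K)"
  "apply_prog (prog_encode PSucc) v K = prod_encode (Suc v, K)"
  "apply_prog (prog_encode PFst) v K = prod_encode (pfst v, K)"
  "apply_prog (prog_encode PSnd) v K = prod_encode (psnd v, K)"
  "apply_prog (prog_encode POracle) v K = prod_encode (0, K)"
  "apply_prog (prog_encode (PPair p q)) v K =
     prod_encode (v, push 0 (prog_encode p) (push 1 (prod_encode (prog_encode q, v)) K))"
  "apply_prog (prog_encode (PComp p q)) v K =
     prod_encode (v, push 0 (prog_encode q) (push 0 (prog_encode p) K))"
  "apply_prog (prog_encode (PPrec p q)) v K =
     prod_encode (pfst v, push 0 (prog_encode p)
       (push 3 (prod_encode (prog_encode q, prod_encode (pfst v, prod_encode (0, psnd v)))) K))"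
  "apply_prog (prog_encode (PMu p)) v K =
     prod_encode (prod_encode (v, 0),
       push 0 (prog_encode p) (push 4 (prod_encode (prog_encode p, prod_encode (v, 0))) K))"
  by (simp_all add: apply_prog_def Let_def div_mod_4)

text \<open>A subprogram runs on top of the frames that wait for its result, hence \<open>K\<close>
  is arbitrary in the induction.\<close>

lemma machine_complete:
  "eval {} p n = Some v \<Longrightarrow>
     reaches (prod_encode (n, push 0 (prog_encode p) K)) (prod_encode (v, K))"
proof (induction p arbitrary: n v K)
  case (PPair p q)
  then obtain a b where ab: "eval {} p n = Some a" "eval {} q n = Some b" "v = prod_encode (a, b)"
    by (auto split: Option.bind_splits)
  have 1: "reaches (prod_encode (n, push 0 (prog_encode p) (push 1 (prod_encode (prog_encode q, n)) K)))
     (prod_encode (a, push 1 (prod_encode (prog_encode q, n)) K))"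
    by (rule PPair.IH) (rule ab)
  have 2: "reaches (prod_encode (a, push 1 (prod_encode (prog_encode q, n)) K))
     (prod_encode (b, push 2 a K))"
    by (rule reaches_step) (simp add: step_resume resume_def Let_def PPair.IH ab)
  have 3: "reaches (prod_encode (b, push 2 a K)) (prod_encode (v, K))"
    by (rule reaches_step) (simp add: step_resume resume_def Let_def ab reaches_refl)
  show ?case
    by (rule reaches_prog) (simp only: apply_prog_simps reaches_trans[OF 1 reaches_trans[OF 2 3]])
next
  case (PComp p q)
  then obtain a where a: "eval {} q n = Some a" "eval {} p a = Some v"
    by (auto split: Option.bind_splits)
  show ?case
    by (rule reaches_prog)
      (simp only: apply_prog_simps reaches_trans[OF PComp.IH(2)[OF a(1)] PComp.IH(1)[OF a(2)]])
next
  case (PPrec p q)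
  obtain a m where n: "n = prod_encode (a, m)" by (metis prod_decode_inverse surj_pair)
  define r where "r = rec_nat (eval {} p a)
    (\<lambda>k r. Option.bind r (\<lambda>v. eval {} q (prod_encode (a, prod_encode (k, v)))))"
  \<comment> \<open>The state after \<open>k\<close> rounds, with the intermediate result
    \<open>v\<close> in front of the frame for the remaining rounds.\<close>
  define S where "S v k = prod_encode (v, push 3 (prod_encode (prog_encode q,
      prod_encode (a, prod_encode (k, m)))) K)" for v k
  have rm: "r m = Some v" using PPrec.prems by (simp add: n r_def)
  have "k \<le> m \<Longrightarrow> r k = Some w \<Longrightarrow> reaches (prod_encode (n, push 0 (prog_encode (PPrec p q)) K)) (S w k)"
    for k w
  proof (induction k arbitrary: w)
    case 0
    then have "reaches (prod_encode (a, push 0 (prog_encode p) L)) (prod_encode (w, L))" for L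
      by (intro PPrec.IH) (simp add: r_def)
    then show ?case
      by (intro reaches_prog)
        (simp only: apply_prog_simps S_def n prod_encode_inverse fst_conv snd_conv)
  next
    case (Suc k)
    then obtain u where u: "r k = Some u" "eval {} q (prod_encode (a, prod_encode (k, u))) = Some w"
      by (auto simp: r_def split: Option.bind_splits)
    have "reaches (S u k) (S w (Suc k))"
      by (rule reaches_step) (use Suc.prems u in \<open>simp add: S_def step_resume resume_def Let_def PPrec.IH\<close>)
    then show ?case using Suc u by (meson Suc_leD reaches_trans)
  qed
  from this[OF order_refl rm] have
    "reaches (prod_encode (n, push 0 (prog_encode (PPrec p q)) K)) (S v m)" .
  moreover have "reaches (S v m) (prod_encode (v, K))"
    by (rule reaches_step) (simp add: S_def step_resume resume_def Let_def reaches_refl)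
  ultimately show ?case by (rule reaches_trans)
next
  case (PMu p)
  define g where "g k = eval {} p (prod_encode (n, k))" for k
  define S where "S v k = prod_encode (v, push 4 (prod_encode (prog_encode p,
      prod_encode (n, k))) K)" for v k
  have ex: "\<exists>k. g k = Some 0 \<and> (\<forall>j<k. g j \<noteq> None)" and v: "v = (LEAST k. g k = Some 0)"
    using PMu.prems by (auto simp: g_def Let_def split: if_splits)
  have gv: "g v = Some 0" unfolding v by (rule LeastI_ex) (use ex in blast)
  \<comment> \<open>Below the least zero all values are defined and nonzero, so the search moves on
    at every \<open>j < v\<close>.\<close>
  have small: "\<exists>w. g j = Some (Suc w)" if "j < v" for j
  proof -
    have "g j \<noteq> Some 0" using that unfolding v by (rule not_less_Least)
    moreover obtain k where k: "g k = Some 0" "\<forall>j<k. g j \<noteq> None" using ex by blast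
    have "v \<le> k" unfolding v by (rule Least_le) (rule k)
    then have "g j \<noteq> None" using k that by simp
    ultimately show ?thesis by (cases "g j"; cases "the (g j)") auto
  qed
  have "k \<le> v \<Longrightarrow> g k = Some w \<Longrightarrow> reaches (prod_encode (n, push 0 (prog_encode (PMu p)) K)) (S w k)"
    for k w
  proof (induction k arbitrary: w)
    case 0
    then have "reaches (prod_encode (prod_encode (n, 0), push 0 (prog_encode p) L)) (prod_encode (w, L))" for L
      by (intro PMu.IH) (simp add: g_def)
    then show ?case
      by (intro reaches_prog)
        (simp only: apply_prog_simps S_def)
  next
    case (Suc k)
    obtain u where u: "g k = Some (Suc u)" using small[of k] Suc.prems by auto
    have "reaches (S (Suc u) k) (S w (Suc k))"
      by (rule reaches_step) (use Suc.prems in \<open>simp add: S_def step_resume resume_def Let_def PMu.IH g_def\<close>)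
    then show ?case using Suc.IH[OF _ u] Suc.prems by (meson Suc_leD reaches_trans)
  qed
  from this[OF order_refl gv] have
    "reaches (prod_encode (n, push 0 (prog_encode (PMu p)) K)) (S 0 v)" .
  moreover have "reaches (S 0 v) (prod_encode (v, K))"
    by (rule reaches_step) (simp add: S_def step_resume resume_def Let_def reaches_refl)
  ultimately show ?case by (rule reaches_trans)
qed (rule reaches_prog, simp only: apply_prog_simps, simp add: reaches_refl)+

lemma computes_machine_step: "computes X machine_step"
  unfolding machine_step_def apply_prog_def resume_def Let_def by (intro computes_intros)

text \<open>Only completeness of the machine is needed, because the simulated programs are total.\<close>

lemma computes_phi:
  assumes "computes X e" "computes X f" and phi: "\<And>n. phi (e n) (f n) = Some (g n)"
  shows "computes X g"
proof -
  define run where "run n t = (machine_step ^^ t) (prod_encode (f n, push 0 (e n) 0))" for n t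
  have run_rec: "run n t = rec_nat (prod_encode (f n, push 0 (e n) 0)) (\<lambda>_. machine_step) t" for n t
    unfolding run_def by (induction t) auto
  have stable: "(machine_step ^^ t) (prod_encode (v, 0)) = prod_encode (v, 0)" for t v
    by (induction t) (simp_all add: machine_step_def)
  have halts: "\<exists>t. run n t = prod_encode (g n, 0)" for n
    using machine_complete[of "prog_decode (e n)" "f n" "g n" 0] phi[of n]
    by (simp add: phi_def phi_oracle_def reaches_def run_def)
  \<comment> \<open>A halted state and the one given by \<open>halts\<close> both persist, so they
    coincide after \<open>t + u\<close> steps.\<close>
  have result: "pfst (run n t) = g n" if halt: "psnd (run n t) = 0" for n t
  proof -
    obtain u where u: "run n u = prod_encode (g n, 0)" using halts by blast
    obtain v where v: "run n t = prod_encode (v, 0)" using halt by (intro that[of "pfst (run n t)"]) (metis prod.collapse prod_decode_inverse)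
    have "run n (t + u) = run n t"
      using v by (simp add: run_def add.commute[of t] funpow_add stable)
    moreover have "run n (t + u) = run n u"
      using u by (simp add: run_def funpow_add stable)
    ultimately show ?thesis using u by (metis fst_conv prod_encode_inverse)
  qed
  have "computes X (\<lambda>n. LEAST t. psnd (run n t) = 0)"
  proof (rule computes_Least)
    show "computes X (\<lambda>z. psnd (run (pfst z) (psnd z)))"
      unfolding run_rec
      by (intro computes_intros computes_rec computes_compose[OF computes_machine_step]
          computes_compose[OF assms(1)] computes_compose[OF assms(2)])
    show "\<exists>k. psnd (run n k) = 0" for n using halts[of n] by (metis prod_encode_inverse snd_conv)
  qed
  then have "computes X (\<lambda>n. pfst (run n (LEAST t. psnd (run n t) = 0)))"
    unfolding run_rec
    by (intro computes_intros computes_rec computes_compose[OF computes_machine_step] assms)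
  moreover have "pfst (run n (LEAST t. psnd (run n t) = 0)) = g n" for n
    by (rule result, rule LeastI_ex) (use halts[of n] in \<open>metis prod_encode_inverse snd_conv\<close>)
  ultimately show ?thesis by simp
qed


section \<open>Atomic diagrams\<close>

lemma inj_tm_encode: "tm_encode t = tm_encode u \<Longrightarrow> t = u"
proof (induction t arbitrary: u)
  case (Elem a)
  then show ?case by (cases u) (auto, presburger+)
next
  case (App s ts)
  then obtain us where u: "u = App s us" and "map tm_encode ts = map tm_encode us"
    by (cases u) (auto simp: list_encode_eq, presburger+)
  then have "ts = us" using App.IH by (metis list.inj_map_strong)
  then show ?case using u by simp
qed

lemma inj_map_tm_encode: "map tm_encode ts = map tm_encode us \<longleftrightarrow> ts = us"
  by (metis inj_tm_encode injI inj_map_eq_map)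

lemma inj_atom_encode: "atom_encode a = atom_encode b \<longleftrightarrow> a = b"
  by (cases a; cases b) (auto simp: list_encode_eq inj_map_tm_encode dest: inj_tm_encode, presburger+)

lemma mem_atomic_diagram:
  "n \<in> atomic_diagram L A \<longleftrightarrow>
     (\<exists>a. wf_atom L A a \<and> atom_encode a = n div 2 \<and> (atom_true A a \<longleftrightarrow> even n))"
proof -
  have "n = 2 * c \<longleftrightarrow> c = n div 2 \<and> even n" "n = Suc (2 * c) \<longleftrightarrow> c = n div 2 \<and> odd n" for c
    by presburger+
  then show ?thesis unfolding atomic_diagram_def by auto
qed

lemma LPos_mem_atomic_diagram:
  "literal_encode (LPos a) \<in> atomic_diagram L A \<longleftrightarrow> wf_atom L A a \<and> atom_true A a"
  by (auto simp: mem_atomic_diagram inj_atom_encode)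

text \<open>The number codes \<open>LPos (AEq (Elem x) (Elem x))\<close>: one outer factor 2 marks
  the equation, the other the positive sign.\<close>

lemma mem_universe_iff:
  "x \<in> universe A \<longleftrightarrow> 4 * prod_encode (2 * x, 2 * x) \<in> atomic_diagram L A"
  using LPos_mem_atomic_diagram[of "AEq (Elem x) (Elem x)" L A] by simp

lemma map_tm_value_Elem [simp]: "map (tm_value A) (map Elem xs) = xs"
  by (induction xs) auto

lemma rel_of_iff_atomic_diagram:
  assumes "L s = Some (RelSym (length xs))" "set xs \<subseteq> universe A"
  shows "rel_of A s xs \<longleftrightarrow>
     2 * (2 * prod_encode (s, list_encode (map (\<lambda>x. 2 * x) xs)) + 1) \<in> atomic_diagram L A"
  using LPos_mem_atomic_diagram[of "ARel s (map Elem xs)" L A] assms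
  by (simp add: list_all_iff comp_def subset_iff del: map_map) (simp add: comp_def)

lemma fun_of_iff_atomic_diagram:
  assumes "L s = Some (FunSym (length xs))" "set xs \<subseteq> universe A" "y \<in> universe A"
  shows "fun_of A s xs = y \<longleftrightarrow>
     4 * prod_encode (2 * prod_encode (s, list_encode (map (\<lambda>x. 2 * x) xs)) + 1, 2 * y)
       \<in> atomic_diagram L A"
  using LPos_mem_atomic_diagram[of "AEq (App s (map Elem xs)) (Elem y)" L A] assms
  by (simp add: list_all_iff comp_def subset_iff del: map_map) (simp add: comp_def)

section \<open>Diagrams in relational languages\<close>

lemma wf_tm_relational:
  assumes "\<And>s k. L s \<noteq> Some (FunSym k)"
  shows "wf_tm L A t \<longleftrightarrow> (\<exists>x\<in>universe A. t = Elem x)"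
  using assms by (cases t) auto

lemma wf_tms_relational:
  assumes "\<And>s k. L s \<noteq> Some (FunSym k)"
  shows "list_all (wf_tm L A) ts \<longleftrightarrow> (\<exists>xs. set xs \<subseteq> universe A \<and> ts = map Elem xs)"
proof
  assume *: "list_all (wf_tm L A) ts"
  have "ts = map Elem (map (tm_value A) ts)"
    using * by (induction ts) (auto simp: wf_tm_relational[OF assms])
  moreover have "set (map (tm_value A) ts) \<subseteq> universe A"
    using * by (induction ts) (auto simp: wf_tm_relational[OF assms])
  ultimately show "\<exists>xs. set xs \<subseteq> universe A \<and> ts = map Elem xs" by blast
qed (auto simp: list_all_iff subset_iff)

text \<open>Without function symbols every closed term is some \<open>Elem x\<close>, so decoding
  needs no recursion on terms: the parity of \<open>n\<close> is the sign, that of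
  \<open>n div 2\<close> tells equations from relations, and \<open>n div 2 div 2\<close> is the
  pair of components.\<close>

lemma mem_atomic_diagram_relational:
  assumes rel: "\<And>s k. L s \<noteq> Some (FunSym k)"
  shows "n \<in> atomic_diagram L A \<longleftrightarrow>
    (if even (n div 2) then
       even (pfst (n div 2 div 2)) \<and> pfst (n div 2 div 2) div 2 \<in> universe A \<and>
       even (psnd (n div 2 div 2)) \<and> psnd (n div 2 div 2) div 2 \<in> universe A \<and>
       (pfst (n div 2 div 2) = psnd (n div 2 div 2) \<longleftrightarrow> even n)
     else
       sort_encode (L (pfst (n div 2 div 2))) = 2 * length (list_decode (psnd (n div 2 div 2))) + 1 \<and>
       (\<forall>t\<in>set (list_decode (psnd (n div 2 div 2))). even t \<and> t div 2 \<in> universe A) \<and>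
       (rel_of A (pfst (n div 2 div 2)) (map (\<lambda>t. t div 2) (list_decode (psnd (n div 2 div 2))))
          \<longleftrightarrow> even n))"
proof (cases "even (n div 2)")
  case True
  define t u where "t = pfst (n div 2 div 2)" and "u = psnd (n div 2 div 2)"
  have n: "n div 2 = 2 * prod_encode (t, u)" using True by (simp add: t_def u_def)
  have "n \<in> atomic_diagram L A \<longleftrightarrow>
     (\<exists>x\<in>universe A. \<exists>y\<in>universe A. 2 * x = t \<and> 2 * y = u \<and> (x = y \<longleftrightarrow> even n))" (is "_ \<longleftrightarrow> ?R")
  proof
    assume "n \<in> atomic_diagram L A"
    then obtain a where a: "wf_atom L A a" "atom_encode a = n div 2" "atom_true A a \<longleftrightarrow> even n"
      by (auto simp: mem_atomic_diagram)
    then show ?R unfolding n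
      by (cases a) (auto simp: wf_tm_relational[OF rel], presburger+)
  next
    assume ?R
    then obtain x y where xy: "x \<in> universe A" "y \<in> universe A" "2 * x = t" "2 * y = u" "x = y \<longleftrightarrow> even n"
      by blast
    then show "n \<in> atomic_diagram L A"
      unfolding mem_atomic_diagram n by (intro exI[of _ "AEq (Elem x) (Elem y)"]) simp
  qed
  also have "\<dots> \<longleftrightarrow> even t \<and> t div 2 \<in> universe A \<and> even u \<and> u div 2 \<in> universe A \<and> (t = u \<longleftrightarrow> even n)"
    by (auto elim!: evenE)
  finally show ?thesis using True by (simp add: t_def u_def)
next
  case False
  define s ts where "s = pfst (n div 2 div 2)" and "ts = list_decode (psnd (n div 2 div 2))"
  have n: "n div 2 = 2 * prod_encode (s, list_encode ts) + 1" using False by (simp add: s_def ts_def)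
  have "n \<in> atomic_diagram L A \<longleftrightarrow>
     (\<exists>xs. L s = Some (RelSym (length xs)) \<and> set xs \<subseteq> universe A \<and> ts = map (\<lambda>x. 2 * x) xs \<and>
        (rel_of A s xs \<longleftrightarrow> even n))" (is "_ \<longleftrightarrow> ?R")
  proof
    assume "n \<in> atomic_diagram L A"
    then obtain a where a: "wf_atom L A a" "atom_encode a = n div 2" "atom_true A a \<longleftrightarrow> even n"
      by (auto simp: mem_atomic_diagram)
    have "\<exists>us. a = ARel s us \<and> map tm_encode us = ts"
    proof (cases a)
      case (AEq t u)
      then have "n div 2 = 2 * prod_encode (tm_encode t, tm_encode u)" using a(2) by simp
      then show ?thesis using False by simp
    next
      case (ARel r us)
      then show ?thesis using a(2) n by (simp add: list_encode_eq)
    qed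
    then obtain us where a_eq: "a = ARel s us" and ts: "map tm_encode us = ts" by blast
    have wf: "list_all (wf_tm L A) us" "L s = Some (RelSym (length us))"
      using a(1) unfolding a_eq by simp_all
    obtain xs where xs: "set xs \<subseteq> universe A" and us: "us = map Elem xs"
      using iffD1[OF wf_tms_relational[OF rel] wf(1)] by blast
    have "map tm_encode us = map (\<lambda>x. 2 * x) xs" "map (tm_value A) us = xs"
      "length us = length xs"
      unfolding us by (simp_all add: comp_def del: map_map) simp
    then show ?R using a(3) ts wf(2) xs unfolding a_eq
      by (intro exI[of _ xs]) (simp only: atom_true.simps)
  next
    assume ?R
    then obtain xs where xs: "L s = Some (RelSym (length xs))" "set xs \<subseteq> universe A"
      "ts = map (\<lambda>x. 2 * x) xs" "rel_of A s xs \<longleftrightarrow> even n"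
      by blast
    show "n \<in> atomic_diagram L A"
      unfolding mem_atomic_diagram n
      by (intro exI[of _ "ARel s (map Elem xs)"])
        (use xs in \<open>simp add: list_all_iff subset_iff del: map_map\<close>, simp add: comp_def)
  qed
  also have "\<dots> \<longleftrightarrow> sort_encode (L s) = 2 * length ts + 1 \<and>
      (\<forall>t\<in>set ts. even t \<and> t div 2 \<in> universe A) \<and> (rel_of A s (map (\<lambda>t. t div 2) ts) \<longleftrightarrow> even n)"
    (is "?R \<longleftrightarrow> ?S")
  proof
    assume ?S
    moreover from this have "L s = Some (RelSym (length ts))"
      by (cases "L s"; cases "the (L s)") (auto, presburger+)
    moreover have "map (\<lambda>x. 2 * x) (map (\<lambda>t. t div 2) ts) = ts"
      using \<open>?S\<close> by (auto intro: map_idI)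
    ultimately show ?R by (intro exI[of _ "map (\<lambda>t. t div 2) ts"]) auto
  qed (auto simp: comp_def subset_iff)
  finally show ?thesis using False by (simp add: s_def ts_def)
qed

text \<open>\<open>R\<close> works on tuple codes and has to be right on well-formed tuples; arity
  and universe are tested separately.\<close>

lemma computable_struc_relational:
  assumes rel: "\<And>s k. L s \<noteq> Some (FunSym k)"
    and L: "computes {} (\<lambda>s. sort_encode (L s))"
    and ne: "universe A \<noteq> {}"
    and univ: "computes_pred {} (\<lambda>u. u \<in> universe A)"
    and R: "computes_pred {} (\<lambda>z. R (pfst z) (psnd z))"
    and rel_of: "\<And>s xs. L s = Some (RelSym (length xs)) \<Longrightarrow> set xs \<subseteq> universe A \<Longrightarrow>
      R s (list_encode xs) \<longleftrightarrow> rel_of A s xs"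
  shows "computable_struc L A"
proof -
  have sort: "L s = Some (RelSym k)" if "sort_encode (L s) = 2 * k + 1" for s k
    using that by (cases "L s"; cases "the (L s)") (auto, presburger+)
  have R': "R s (list_encode (map (\<lambda>t. t div 2) ts)) \<longleftrightarrow> rel_of A s (map (\<lambda>t. t div 2) ts)"
    if "sort_encode (L s) = 2 * length ts + 1" "\<forall>t\<in>set ts. even t \<and> t div 2 \<in> universe A" for s ts
    by (rule rel_of) (use sort that in \<open>simp_all add: image_subset_iff\<close>)
  have "n \<in> atomic_diagram L A \<longleftrightarrow>
    (if even (n div 2) then
       even (pfst (n div 2 div 2)) \<and> pfst (n div 2 div 2) div 2 \<in> universe A \<and>
       even (psnd (n div 2 div 2)) \<and> psnd (n div 2 div 2) div 2 \<in> universe A \<and>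
       (pfst (n div 2 div 2) = psnd (n div 2 div 2) \<longleftrightarrow> even n)
     else
       sort_encode (L (pfst (n div 2 div 2))) = 2 * length (list_decode (psnd (n div 2 div 2))) + 1 \<and>
       (\<forall>t\<in>set (list_decode (psnd (n div 2 div 2))). even t \<and> t div 2 \<in> universe A) \<and>
       (R (pfst (n div 2 div 2)) (list_encode (map (\<lambda>t. t div 2) (list_decode (psnd (n div 2 div 2)))))
          \<longleftrightarrow> even n))" for n
    unfolding mem_atomic_diagram_relational[OF rel]
    by (intro if_cong refl conj_cong) (simp only: R')
  then have "computable_set (atomic_diagram L A)"
    unfolding computable_set_iff
    by (simp only:) (intro computes_intros computes_compose[OF univ] computes_compose[OF L]
        computes_compose2[OF R])
  then show ?thesis
    using rel ne L by (simp add: computable_struc_def computable_language_def computable_fun_iff is_struc_def)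
qed

section \<open>Identity and inverse isomorphisms\<close>

lemma is_iso_id: "is_iso L A A (\<lambda>x. x)"
  by (simp add: is_iso_def bij_betw_def)

text \<open>\<open>is_struc\<close> guarantees that function values of \<open>A\<close> lie in the
  universe, where the inverse cancels \<open>h\<close>.\<close>

lemma is_iso_inv_into:
  assumes iso: "is_iso L A B h" and A: "is_struc L A"
  shows "is_iso L B A (inv_into (universe A) h)" (is "is_iso _ _ _ ?g")
proof -
  have bij: "bij_betw h (universe A) (universe B)" using iso by (simp add: is_iso_def)
  have g: "?g y \<in> universe A" "h (?g y) = y" if "y \<in> universe B" for y
    using bij that by (auto simp: bij_betw_def inv_into_into f_inv_into_f)
  have list: "set (map ?g ys) \<subseteq> universe A" "map h (map ?g ys) = ys" if "set ys \<subseteq> universe B" for ys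
    using that g by (auto intro!: map_idI simp: subset_iff)
  show ?thesis
    unfolding is_iso_def
  proof (intro conjI allI impI; (elim conjE)?)
    show "bij_betw ?g (universe B) (universe A)" by (rule bij_betw_inv_into[OF bij])
  next
    fix s ys assume "L s = Some (RelSym (length ys))" and ys: "set ys \<subseteq> universe B"
    then have "rel_of B s (map h (map ?g ys)) \<longleftrightarrow> rel_of A s (map ?g ys)"
      using iso list(1)[OF ys] unfolding is_iso_def by (metis length_map)
    then show "rel_of A s (map ?g ys) \<longleftrightarrow> rel_of B s ys" using list(2)[OF ys] by simp
  next
    fix s ys assume s: "L s = Some (FunSym (length ys))" and ys: "set ys \<subseteq> universe B"
    then have "fun_of B s (map h (map ?g ys)) = h (fun_of A s (map ?g ys))"
      using iso list(1)[OF ys] unfolding is_iso_def by (metis length_map)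
    then have "fun_of B s ys = h (fun_of A s (map ?g ys))" using list(2)[OF ys] by simp
    moreover have "fun_of A s (map ?g ys) \<in> universe A"
      using A s list(1)[OF ys] unfolding is_struc_def by (metis length_map)
    ultimately show "fun_of A s (map ?g ys) = ?g (fun_of B s ys)"
      using bij by (simp add: bij_betw_inv_into_left)
  qed
qed


section \<open>Sums over finite sets\<close>

text \<open>
  An element of the sum is a triple of a code of a finite set \<open>S\<close>, a coordinate \<open>j\<close> and a point of
  the fibre at \<open>(S, j)\<close>, which is \<open>B j\<close> if \<open>j\<close> is in \<open>S\<close> and \<open>A j\<close> otherwise.
\<close>

abbreviation elt :: "nat \<Rightarrow> nat \<Rightarrow> nat \<Rightarrow> nat" where
  "elt c j x \<equiv> prod_encode (c, prod_encode (j, x))"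

abbreviation idx :: "nat \<Rightarrow> nat" where "idx u \<equiv> pfst u"
abbreviation crd :: "nat \<Rightarrow> nat" where "crd u \<equiv> pfst (psnd u)"
abbreviation pnt :: "nat \<Rightarrow> nat" where "pnt u \<equiv> psnd (psnd u)"

definition fibre :: "(nat \<Rightarrow> 'a) \<Rightarrow> (nat \<Rightarrow> 'a) \<Rightarrow> nat \<Rightarrow> nat \<Rightarrow> 'a" where
  "fibre A B c j = (if j \<in> set_decode c then B j else A j)"

text \<open>
  The symbol \<open>(i, 0)\<close> says that two elements have the same index, the second one having coordinate
  \<open>i\<close>.  The symbol \<open>(i, Suc s)\<close> interprets the symbol \<open>s\<close> of \<open>L i\<close>, the graph of \<open>s\<close> if \<open>s\<close> is a
  function symbol.  Its additional first argument \<open>y\<close> selects the fibre, which is needed for \<open>s\<close> of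
  arity 0, and is the value of the function in the second case.
\<close>

definition sum_lang :: "(nat \<Rightarrow> language) \<Rightarrow> language" where
  "sum_lang L r =
     (if psnd r = 0 then Some (RelSym 2)
      else case L (pfst r) (psnd r - 1) of
        None \<Rightarrow> None
      | Some (RelSym k) \<Rightarrow> Some (RelSym (Suc k))
      | Some (FunSym k) \<Rightarrow> Some (RelSym (Suc k)))"

definition sum_rel ::
  "(nat \<Rightarrow> language) \<Rightarrow> (nat \<Rightarrow> struc) \<Rightarrow> (nat \<Rightarrow> struc) \<Rightarrow> nat \<Rightarrow> nat list \<Rightarrow> bool" where
  "sum_rel L A B r xs =
     (if psnd r = 0 then idx (xs ! 0) = idx (xs ! 1) \<and> crd (xs ! 1) = pfst r
      else (\<forall>z\<in>set xs. idx z = idx (hd xs) \<and> crd z = pfst r) \<and>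
        (let X = fibre A B (idx (hd xs)) (pfst r) in
         case L (pfst r) (psnd r - 1) of
           None \<Rightarrow> False
         | Some (RelSym _) \<Rightarrow> rel_of X (psnd r - 1) (map pnt (tl xs))
         | Some (FunSym _) \<Rightarrow> fun_of X (psnd r - 1) (map pnt (tl xs)) = pnt (hd xs)))"

text \<open>The parity of the index set separates the two copies, \<open>True\<close> being the even
  one; the relations are the same for both.\<close>

definition parity_sum ::
  "(nat \<Rightarrow> language) \<Rightarrow> (nat \<Rightarrow> struc) \<Rightarrow> (nat \<Rightarrow> struc) \<Rightarrow> bool \<Rightarrow> struc" where
  "parity_sum L A B b =
     \<lparr>universe = {u. (even (card (set_decode (idx u))) \<longleftrightarrow> b) \<and> pnt u \<in> universe (fibre A B (idx u) (crd u))},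
      rel_of = sum_rel L A B,
      fun_of = \<lambda>_ _. 0\<rparr>"

lemma sum_lang_relational: "sum_lang L r \<noteq> Some (FunSym k)"
  by (auto simp: sum_lang_def split: option.splits sym_sort.splits)

lemma mem_universe_parity_sum:
  "u \<in> universe (parity_sum L A B b) \<longleftrightarrow>
     (even (card (set_decode (idx u))) \<longleftrightarrow> b) \<and> pnt u \<in> universe (fibre A B (idx u) (crd u))"
  by (simp add: parity_sum_def)

lemma rel_of_parity_sum [simp]: "rel_of (parity_sum L A B b) = sum_rel L A B"
  by (simp add: parity_sum_def)

lemma sum_rel_idx: "sum_rel L A B (prod_encode (i, 0)) [u, v] \<longleftrightarrow> idx u = idx v \<and> crd v = i"
  by (simp add: sum_rel_def)

lemma sum_lang_idx: "sum_lang L (prod_encode (i, 0)) = Some (RelSym 2)"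
  by (simp add: sum_lang_def)

lemma sum_rel_elt_rel:
  assumes "L i s = Some (RelSym k)"
  shows "sum_rel L A B (prod_encode (i, Suc s)) (elt c i y # map (elt c i) xs)
    \<longleftrightarrow> rel_of (fibre A B c i) s xs"
  using assms by (simp add: sum_rel_def comp_def)

lemma sum_rel_elt_fun:
  assumes "L i s = Some (FunSym k)"
  shows "sum_rel L A B (prod_encode (i, Suc s)) (elt c i y # map (elt c i) xs)
    \<longleftrightarrow> fun_of (fibre A B c i) s xs = y"
  using assms by (simp add: sum_rel_def comp_def)

text \<open>Symmetric difference with \<open>{i}\<close> on codes: it switches the bit of weight
  \<open>2 ^ i\<close>.\<close>

definition flip :: "nat \<Rightarrow> nat \<Rightarrow> nat" where
  "flip i c = (if i \<in> set_decode c then c - 2 ^ i else c + 2 ^ i)"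

lemma set_decode_flip:
  "set_decode (flip i c) = (if i \<in> set_decode c then set_decode c - {i} else insert i (set_decode c))"
proof -
  have "flip i c = set_encode (if i \<in> set_decode c then set_decode c - {i} else insert i (set_decode c))"
  proof (cases "i \<in> set_decode c")
    case True
    have "set_encode (set_decode c - {i}) = set_encode (set_decode c) - 2 ^ i"
      unfolding set_encode_def using True by (subst sum_diff1_nat) simp
    then show ?thesis using True by (simp add: flip_def)
  next
    case False
    then show ?thesis by (simp add: flip_def set_encode_insert)
  qed
  then show ?thesis by simp
qed

lemma mem_set_decode_flip: "j \<in> set_decode (flip i c) \<longleftrightarrow> (j \<in> set_decode c \<longleftrightarrow> j \<noteq> i)"
  by (auto simp: set_decode_flip)

lemma flip_flip [simp]: "flip i (flip i c) = c"
proof -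
  have "set_decode (flip i (flip i c)) = set_decode c"
    by (rule set_eqI) (unfold mem_set_decode_flip, blast)
  from arg_cong[OF this, of set_encode] show ?thesis by simp
qed

lemma flip_eq_iff [simp]: "flip i c = flip i d \<longleftrightarrow> c = d"
  by (metis flip_flip)

lemma even_card_flip: "even (card (set_decode (flip i c))) \<longleftrightarrow> odd (card (set_decode c))"
proof (cases "i \<in> set_decode c")
  case True
  then have "card (set_decode c) = Suc (card (set_decode c - {i}))" by (intro card.remove) (use True in simp_all)
  then show ?thesis using True by (simp only: set_decode_flip if_True even_Suc not_not)
next
  case False
  then show ?thesis by (simp add: set_decode_flip)
qed

text \<open>As \<open>flip i\<close> is injective on indices and coordinates stay fixed, the map
  preserves lying in a common fibre; inside each fibre \<open>g\<close> takes care of the symbols.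
  The parity of the index set changes, which exchanges the two copies.\<close>

lemma is_iso_parity_sum:
  assumes g: "\<And>c j. is_iso (L j) (fibre A B c j) (fibre A B (flip i c) j) (g c j)"
    and struc: "\<And>c j. is_struc (L j) (fibre A B c j)"
  shows "is_iso (sum_lang L) (parity_sum L A B b) (parity_sum L A B (\<not> b))
    (\<lambda>u. elt (flip i (idx u)) (crd u) (g (idx u) (crd u) (pnt u)))" (is "is_iso _ ?M ?N ?F")
proof -
  have gb: "bij_betw (g c j) (universe (fibre A B c j)) (universe (fibre A B (flip i c) j))" for c j
    using g by (simp add: is_iso_def)
  show ?thesis
    unfolding is_iso_def
  proof (intro conjI allI impI; (elim conjE)?)
    show "bij_betw ?F (universe ?M) (universe ?N)"
      unfolding bij_betw_def
    proof
      show "inj_on ?F (universe ?M)"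
      proof (rule inj_onI)
        fix u v assume uv: "u \<in> universe ?M" "v \<in> universe ?M" and eq: "?F u = ?F v"
        then have *: "idx u = idx v" "crd u = crd v" by auto
        then have "g (idx u) (crd u) (pnt u) = g (idx u) (crd u) (pnt v)" using eq by simp
        then have "pnt u = pnt v"
          using gb[of "idx u" "crd u"] uv * by (auto simp: mem_universe_parity_sum bij_betw_def dest: inj_onD)
        with * show "u = v" by (metis prod.collapse prod_decode_inverse)
      qed
      show "?F ` universe ?M = universe ?N"
      proof (intro subset_antisym subsetI)
        fix v assume "v \<in> ?F ` universe ?M"
        then show "v \<in> universe ?N"
          using bij_betw_apply[OF gb] by (auto simp: mem_universe_parity_sum even_card_flip)
      next
        fix v assume v: "v \<in> universe ?N"
        then have "pnt v \<in> g (flip i (idx v)) (crd v) ` universe (fibre A B (flip i (idx v)) (crd v))"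
          using gb[of "flip i (idx v)" "crd v"] by (auto simp: mem_universe_parity_sum bij_betw_def)
        then obtain x where x: "x \<in> universe (fibre A B (flip i (idx v)) (crd v))"
          "g (flip i (idx v)) (crd v) x = pnt v" by auto
        then have "v = ?F (elt (flip i (idx v)) (crd v) x)" by simp
        moreover have "elt (flip i (idx v)) (crd v) x \<in> universe ?M"
          using v x by (simp add: mem_universe_parity_sum even_card_flip)
        ultimately show "v \<in> ?F ` universe ?M" by (rule image_eqI)
      qed
    qed
  next
    fix r and us :: "nat list"
    assume r: "sum_lang L r = Some (RelSym (length us))" and us: "set us \<subseteq> universe ?M"
    show "rel_of ?N r (map ?F us) \<longleftrightarrow> rel_of ?M r us"
    proof (cases "psnd r = 0")
      case True
      then have "length us = Suc (Suc 0)" using r by (simp add: sum_lang_def numeral_2_eq_2)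
      then obtain u v where "us = [u, v]" by (auto simp: length_Suc_conv)
      then show ?thesis using True by (simp add: sum_rel_def)
    next
      case False
      define j s where "j = pfst r" and "s = psnd r - 1"
      have r': "r = prod_encode (j, Suc s)" using False by (simp add: j_def s_def)
      obtain u ws where us': "us = u # ws"
        using r False by (cases us) (auto simp: sum_lang_def split: option.splits sym_sort.splits)
      show ?thesis
      proof (cases "\<forall>z\<in>set us. idx z = idx u \<and> crd z = j")
        \<comment> \<open>The arguments do not share the fibre required by the symbol, so the
          relation fails on both sides.\<close>
        case False
        then show ?thesis by (auto simp: sum_rel_def r' us')
      next
        case True
        define c where "c = idx u"
        define xs where "xs = map pnt ws"
        have "z = elt c j (pnt z)" if "z \<in> set us" for z
          using True that by (metis c_def prod.collapse prod_decode_inverse)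
        then have u: "u = elt c j (pnt u)" and ws: "ws = map (elt c j) xs"
          by (auto simp: us' xs_def intro!: map_idI[symmetric])
        have pnt: "pnt z \<in> universe (fibre A B c j)" if "z \<in> set us" for z
          using us True that unfolding c_def by (auto simp: mem_universe_parity_sum subset_iff)
        have xs: "set xs \<subseteq> universe (fibre A B c j)" and y: "pnt u \<in> universe (fibre A B c j)"
          using pnt by (auto simp: us' xs_def)
        have Fus: "map ?F us = elt (flip i c) j (g c j (pnt u)) # map (elt (flip i c) j) (map (g c j) xs)"
          unfolding us' by (subst u, subst ws) simp
        have us_eq: "us = elt c j (pnt u) # map (elt c j) xs"
          unfolding us' using u ws by simp
        consider k where "L j s = Some (RelSym k)" "k = length xs"
          | k where "L j s = Some (FunSym k)" "k = length xs"
          using r False by (auto simp: sum_lang_def r' us' xs_def split: option.splits sym_sort.splits)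
        then show ?thesis
        proof cases
          case 1
          then have "rel_of (fibre A B (flip i c) j) s (map (g c j) xs) \<longleftrightarrow> rel_of (fibre A B c j) s xs"
            using g[of j c] xs by (auto simp: is_iso_def)
          then show ?thesis
            unfolding rel_of_parity_sum Fus r' by (subst us_eq) (simp only: sum_rel_elt_rel[of L, OF 1(1)])
        next
          case 2
          then have "fun_of (fibre A B (flip i c) j) s (map (g c j) xs) = g c j (fun_of (fibre A B c j) s xs)"
            using g[of j c] xs by (auto simp: is_iso_def)
          moreover have "fun_of (fibre A B c j) s xs \<in> universe (fibre A B c j)"
            using struc 2 xs by (auto simp: is_struc_def)
          \<comment> \<open>The graph transfers because \<open>g c j\<close> is injective on the
            fibre and both the function value and \<open>pnt u\<close> lie there.\<close>
          ultimately have "fun_of (fibre A B (flip i c) j) s (map (g c j) xs) = g c j (pnt u)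
              \<longleftrightarrow> fun_of (fibre A B c j) s xs = pnt u"
            using gb[of c j] y by (auto simp: bij_betw_def dest: inj_onD)
          then show ?thesis
            unfolding rel_of_parity_sum Fus r' by (subst us_eq) (simp only: sum_rel_elt_fun[of L, OF 2(1)])
        qed
      qed
    qed
  next
    fix r and us :: "nat list"
    assume "sum_lang L r = Some (FunSym (length us))"
    then show "fun_of ?N r (map ?F us) = ?F (fun_of ?M r us)" by (simp add: sum_lang_relational)
  qed
qed

text \<open>
  The fibres at the empty set are the \<open>A j\<close>.  An isomorphism sends all of them to the fibres at one
  finite set, which is nonempty because its cardinality is odd.
\<close>

lemma is_iso_parity_sumD:
  assumes F: "is_iso (sum_lang L) (parity_sum L A B True) (parity_sum L A B False) F"
    and struc: "\<And>j. is_struc (L j) (A j)"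
  obtains i c h where "is_iso (L i) (A i) (B i) h"
    and "\<And>x. x \<in> universe (A i) \<Longrightarrow> F (elt 0 i x) = elt c i (h x)"
proof -
  let ?M = "parity_sum L A B True" and ?N = "parity_sum L A B False"
  have bij: "bij_betw F (universe ?M) (universe ?N)" using F by (simp add: is_iso_def)
  have rel: "sum_rel L A B r (map F us) \<longleftrightarrow> sum_rel L A B r us"
    if "sum_lang L r = Some (RelSym (length us))" "set us \<subseteq> universe ?M" for r us
    using F that by (auto simp: is_iso_def)
  have M0: "elt 0 j x \<in> universe ?M \<longleftrightarrow> x \<in> universe (A j)" for j x
    by (simp add: mem_universe_parity_sum fibre_def)
  have ne: "\<exists>x. x \<in> universe (A j)" for j using struc[of j] by (auto simp: is_struc_def)
  obtain x0 where "x0 \<in> universe (A 0)" using ne by blast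
  \<comment> \<open>A base point at the empty set, whose code is 0; the index of its image will
    serve for all coordinates.\<close>
  define u0 where "u0 = elt 0 0 x0"
  have u0: "u0 \<in> universe ?M" unfolding u0_def M0 by fact
  define c where "c = idx (F u0)"
  have "F u0 \<in> universe ?N" using bij u0 by (auto simp: bij_betw_def)
  then have odd: "odd (card (set_decode c))" by (simp add: mem_universe_parity_sum c_def)
  then have "set_decode c \<noteq> {}" by force
  then obtain i where i: "i \<in> set_decode c" by blast
  \<comment> \<open>The symbol \<open>(j, 0)\<close> leaves the coordinate of its first argument
    free, so \<open>u0\<close> can be compared with elements of any coordinate \<open>j\<close>:
    exactly the elements of index 0 go to index \<open>c\<close>, keeping their coordinates.\<close>
  have idx_F: "c = idx (F u) \<and> crd (F u) = j \<longleftrightarrow> 0 = idx u \<and> crd u = j" if "u \<in> universe ?M" for u j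
  proof -
    have "sum_rel L A B (prod_encode (j, 0)) (map F [u0, u])
        \<longleftrightarrow> sum_rel L A B (prod_encode (j, 0)) [u0, u]"
      by (rule rel) (use u0 that in \<open>simp_all add: sum_lang_idx\<close>)
    moreover have "idx u0 = 0" by (simp add: u0_def)
    ultimately show ?thesis unfolding list.map sum_rel_idx c_def by (simp only:)
  qed
  define h where "h x = pnt (F (elt 0 i x))" for x
  have Fh: "F (elt 0 i x) = elt c i (h x)" if "x \<in> universe (A i)" for x
    using idx_F[of "elt 0 i x" i] that by (simp add: M0 h_def) (metis prod.collapse prod_decode_inverse)
  have N_c: "elt c i y \<in> universe ?N \<longleftrightarrow> y \<in> universe (B i)" for y
    using odd i by (simp add: mem_universe_parity_sum fibre_def)
  have map_Fh: "map F (elt 0 i y # map (elt 0 i) xs) = elt c i (h y) # map (elt c i) (map h xs)"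
    if "set xs \<subseteq> universe (A i)" "y \<in> universe (A i)" for xs y
    using that Fh by auto
  have fib: "fibre A B 0 i = A i" "fibre A B c i = B i" using i by (simp_all add: fibre_def)
  have sub: "set (elt 0 i y # map (elt 0 i) xs) \<subseteq> universe ?M"
    if "set xs \<subseteq> universe (A i)" "y \<in> universe (A i)" for xs y
    using that by (auto simp: M0)
  have "is_iso (L i) (A i) (B i) h"
    unfolding is_iso_def
  proof (intro conjI allI impI; (elim conjE)?)
    show "bij_betw h (universe (A i)) (universe (B i))"
      unfolding bij_betw_def
    proof
      show "inj_on h (universe (A i))"
      proof (rule inj_onI)
        fix x y assume xy: "x \<in> universe (A i)" "y \<in> universe (A i)" "h x = h y"
        then have "F (elt 0 i x) = F (elt 0 i y)" by (simp add: Fh)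
        then have "elt 0 i x = elt 0 i y" using bij xy M0 by (meson bij_betw_def inj_onD)
        then show "x = y" by simp
      qed
      show "h ` universe (A i) = universe (B i)"
      proof (intro subset_antisym subsetI)
        fix y assume "y \<in> h ` universe (A i)"
        then obtain x where x: "x \<in> universe (A i)" "y = h x" by auto
        then have "F (elt 0 i x) \<in> universe ?N" using bij M0 by (auto simp: bij_betw_def)
        then show "y \<in> universe (B i)" using x by (simp add: Fh N_c)
      next
        fix y assume "y \<in> universe (B i)"
        then obtain u where u: "u \<in> universe ?M" "F u = elt c i y"
          using bij N_c by (metis bij_betw_imp_surj_on imageE)
        \<comment> \<open>\<open>idx_F\<close> from left to right: an image at index
          \<open>c\<close> and coordinate \<open>i\<close> comes from index 0 and coordinate
          \<open>i\<close>, so \<open>h\<close> is onto.\<close>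
        then have *: "idx u = 0" "crd u = i" using idx_F[of u i] by auto
        then have "u = elt 0 i (pnt u)" by (metis prod.collapse prod_decode_inverse)
        with u have "y = h (pnt u)" "pnt u \<in> universe (A i)"
          by (metis h_def prod_encode_inverse snd_conv, metis M0)
        then show "y \<in> h ` universe (A i)" by blast
      qed
    qed
  next
    fix s xs assume s: "L i s = Some (RelSym (length xs))" and xs: "set xs \<subseteq> universe (A i)"
    \<comment> \<open>Any element serves as the additional first argument, which only selects the
      fibre.\<close>
    obtain y where y: "y \<in> universe (A i)" using ne by blast
    show "rel_of (B i) s (map h xs) \<longleftrightarrow> rel_of (A i) s xs"
      using rel[OF _ sub[OF xs y], of "prod_encode (i, Suc s)"] s
      unfolding map_Fh[OF xs y] by (simp only: sum_rel_elt_rel fib) (simp add: sum_lang_def)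
  next
    fix s xs assume s: "L i s = Some (FunSym (length xs))" and xs: "set xs \<subseteq> universe (A i)"
    \<comment> \<open>With the value itself as first argument the graph relation holds, hence so
      does its image, which is the equation claimed.\<close>
    have y: "fun_of (A i) s xs \<in> universe (A i)" using struc s xs by (auto simp: is_struc_def)
    show "fun_of (B i) s (map h xs) = h (fun_of (A i) s xs)"
      using rel[OF _ sub[OF xs y], of "prod_encode (i, Suc s)"] s
      unfolding map_Fh[OF xs y] by (simp only: sum_rel_elt_fun fib) (simp add: sum_lang_def)
  qed
  then show thesis using that Fh by blast
qed

section \<open>Deciding the language and the relations of the sums\<close>

lemma computes_flip [computes_intros]:
  assumes "computes X f" "computes X g" shows "computes X (\<lambda>n. flip (f n) (g n))"
  unfolding flip_def by (intro computes_intros assms)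

text \<open>Subtracting 1 and halving recovers the arity \<open>k\<close> from
  \<open>2 * k + 1\<close> as well as from \<open>2 * k + 2\<close>; the result codes a relation
  symbol of arity \<open>k + 1\<close>, and 5 codes one of arity 2.\<close>

lemma sort_encode_sum_lang:
  "sort_encode (sum_lang L r) =
     (if psnd r = 0 then 5
      else if sort_encode (L (pfst r) (psnd r - 1)) = 0 then 0
      else 2 * ((sort_encode (L (pfst r) (psnd r - 1)) - 1) div 2) + 3)"
  by (auto simp: sum_lang_def split: option.splits sym_sort.splits)

text \<open>Reduces the relations to the diagrams of the fibres, which are uniformly decidable.
  Where the sort code is tested, an even one means a function symbol, the code 0 being excluded by
  the assumption on \<open>r\<close>.\<close>

lemma sum_rel_iff_atomic_diagram:
  assumes r: "sum_lang L r = Some (RelSym (length us))" and us: "set us \<subseteq> universe (parity_sum L A B b)"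
  shows "sum_rel L A B r us \<longleftrightarrow>
    (if psnd r = 0 then idx (us ! 0) = idx (us ! 1) \<and> crd (us ! 1) = pfst r
     else (\<forall>z\<in>set us. idx z = idx (hd us) \<and> crd z = pfst r) \<and>
       (if even (sort_encode (L (pfst r) (psnd r - 1))) then
          4 * prod_encode (2 * prod_encode (psnd r - 1, list_encode (map (\<lambda>z. 2 * pnt z) (tl us))) + 1,
            2 * pnt (hd us)) \<in> atomic_diagram (L (pfst r)) (fibre A B (idx (hd us)) (pfst r))
        else
          2 * (2 * prod_encode (psnd r - 1, list_encode (map (\<lambda>z. 2 * pnt z) (tl us))) + 1)
            \<in> atomic_diagram (L (pfst r)) (fibre A B (idx (hd us)) (pfst r))))"
proof (cases "psnd r = 0 \<or> \<not> (\<forall>z\<in>set us. idx z = idx (hd us) \<and> crd z = pfst r)")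
  case True
  then show ?thesis by (auto simp: sum_rel_def)
next
  case False
  define i s where "i = pfst r" and "s = psnd r - 1"
  obtain u ws where us': "us = u # ws"
    using r False by (cases us) (auto simp: sum_lang_def split: option.splits sym_sort.splits)
  have pnt: "pnt z \<in> universe (fibre A B (idx u) i)" if "z \<in> set us" for z
    using us False that by (auto simp: mem_universe_parity_sum subset_iff us' i_def)
  then have ws: "set (map pnt ws) \<subseteq> universe (fibre A B (idx u) i)"
    and u: "pnt u \<in> universe (fibre A B (idx u) i)" by (auto simp: us')
  have r': "r = prod_encode (i, Suc s)" using False by (simp add: i_def s_def)
  have tl: "map (\<lambda>z. 2 * pnt z) ws = map (\<lambda>x. 2 * x) (map pnt ws)" by simp
  consider "L i s = Some (RelSym (length (map pnt ws)))" | "L i s = Some (FunSym (length (map pnt ws)))"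
    using r False by (auto simp: sum_lang_def us' i_def s_def split: option.splits sym_sort.splits)
  then show ?thesis
  proof cases
    case 1
    show ?thesis
      using False 1 rel_of_iff_atomic_diagram[of "L i", OF 1 ws]
      unfolding us' list.sel tl r' by (simp add: sum_rel_def del: map_map)
  next
    case 2
    show ?thesis
      using False 2 fun_of_iff_atomic_diagram[of "L i", OF 2 ws u]
      unfolding us' list.sel tl r' by (simp add: sum_rel_def del: map_map)
  qed
qed


section \<open>The isomorphism spectrum of the sums\<close>

text \<open>The index of the decision procedure varies with \<open>n\<close>, which is why the
  universal machine is called through \<open>computes_phi\<close>.\<close>

lemma computes_atomic_diagram:
  assumes "uniformly_computable UNIV L A" "computes X e" "computes X q"
  shows "computes_pred X (\<lambda>n. q n \<in> atomic_diagram (L (e n)) (A (e n)))"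
proof -
  obtain f where f: "computable_fun f" "\<And>x. decides (phi (f x)) (atomic_diagram (L x) (A x))"
    using assms(1) by (auto simp: uniformly_computable_def)
  have "computes X f" using f(1) by (simp add: computable_fun_iff computes_oracle_free)
  from computes_compose[OF this assms(2)] assms(3) show ?thesis
    by (rule computes_phi) (use f(2) in \<open>simp add: decides_def\<close>)
qed

lemma computes_sort_encode:
  assumes "uniformly_computable UNIV L A" "computes X e" "computes X q"
  shows "computes X (\<lambda>n. sort_encode (L (e n) (q n)))"
proof -
  obtain f where f: "computable_fun f" "\<And>x. phi (f x) = (\<lambda>s. Some (sort_encode (L x s)))"
    using assms(1) by (auto simp: uniformly_computable_def uniformly_computable_languages_def)
  have "computes X f" using f(1) by (simp add: computable_fun_iff computes_oracle_free)
  from computes_compose[OF this assms(2)] assms(3) show ?thesis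
    by (rule computes_phi) (simp add: f(2))
qed

lemma computes_fibre_diagram:
  assumes "uniformly_computable UNIV L A" "uniformly_computable UNIV L B"
    and "computes X c" "computes X e" "computes X q"
  shows "computes_pred X (\<lambda>n. q n \<in> atomic_diagram (L (e n)) (fibre A B (c n) (e n)))"
proof -
  have "x \<in> atomic_diagram (L j) (fibre A B d j) \<longleftrightarrow>
      (if j \<in> set_decode d then x \<in> atomic_diagram (L j) (B j) else x \<in> atomic_diagram (L j) (A j))"
    for x j d by (simp add: fibre_def)
  then show ?thesis
    by (simp only:) (intro computes_intros computes_atomic_diagram assms)
qed

lemma computes_universe_parity_sum:
  assumes "uniformly_computable UNIV L A" "uniformly_computable UNIV L B" "computes X f"
  shows "computes_pred X (\<lambda>n. f n \<in> universe (parity_sum L A B b))"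
proof -
  have "u \<in> universe (parity_sum L A B b) \<longleftrightarrow> (even (card (set_decode (idx u))) \<longleftrightarrow> b) \<and>
      4 * prod_encode (2 * pnt u, 2 * pnt u) \<in> atomic_diagram (L (crd u)) (fibre A B (idx u) (crd u))" for u
    unfolding mem_universe_parity_sum
    by (subst mem_universe_iff[of _ "fibre A B (idx u) (crd u)" "L (crd u)"]) (rule refl)
  then show ?thesis
    by (simp only:) (intro computes_intros computes_fibre_diagram assms)
qed

lemma is_struc_fibre:
  assumes "uniformly_computable UNIV L A" "uniformly_computable UNIV L B"
  shows "is_struc (L j) (fibre A B c j)"
  using assms by (simp add: uniformly_computable_def computable_struc_def fibre_def)

lemma computable_struc_parity_sum:
  assumes A: "uniformly_computable UNIV L A" and B: "uniformly_computable UNIV L B"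
  shows "computable_struc (sum_lang L) (parity_sum L A B b)"
proof (rule computable_struc_relational)
  show "sum_lang L s \<noteq> Some (FunSym k)" for s k by (rule sum_lang_relational)
  show "computes {} (\<lambda>s. sort_encode (sum_lang L s))"
    unfolding sort_encode_sum_lang by (intro computes_intros computes_sort_encode[OF A])
  show "universe (parity_sum L A B b) \<noteq> {}"
  proof -
    \<comment> \<open>The code 0 is that of the empty set and 1 that of \<open>{0}\<close>, one for
      each parity.\<close>
    define c where "c = (if b then 0 else 1 :: nat)"
    have "set_decode 1 = {0}" using set_encode_inverse[of "{0}"] by (simp add: set_encode_def)
    then have c: "even (card (set_decode c)) \<longleftrightarrow> b" by (simp add: c_def)
    obtain x where "x \<in> universe (fibre A B c 0)"
      using is_struc_fibre[OF A B, of 0 c] by (auto simp: is_struc_def)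
    then have "elt c 0 x \<in> universe (parity_sum L A B b)" by (simp add: mem_universe_parity_sum c)
    then show ?thesis by blast
  qed
  show "computes_pred {} (\<lambda>u. u \<in> universe (parity_sum L A B b))"
    by (intro computes_universe_parity_sum A B computes_id)
  \<comment> \<open>Works on the code \<open>l\<close> of a tuple: \<open>pfst (l - 1)\<close> is
    its head, \<open>psnd (l - 1)\<close> the code of its tail and
    \<open>pfst (psnd (l - 1) - 1)\<close> its second entry.\<close>
  define R where "R r l \<longleftrightarrow>
    (if psnd r = 0 then idx (pfst (l - 1)) = idx (pfst (psnd (l - 1) - 1)) \<and>
       crd (pfst (psnd (l - 1) - 1)) = pfst r
     else (\<forall>z\<in>set (list_decode l). idx z = idx (pfst (l - 1)) \<and> crd z = pfst r) \<and>
       (if even (sort_encode (L (pfst r) (psnd r - 1))) then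
          4 * prod_encode (2 * prod_encode (psnd r - 1,
            list_encode (map (\<lambda>z. 2 * pnt z) (list_decode (psnd (l - 1))))) + 1, 2 * pnt (pfst (l - 1)))
            \<in> atomic_diagram (L (pfst r)) (fibre A B (idx (pfst (l - 1))) (pfst r))
        else
          2 * (2 * prod_encode (psnd r - 1,
            list_encode (map (\<lambda>z. 2 * pnt z) (list_decode (psnd (l - 1))))) + 1)
            \<in> atomic_diagram (L (pfst r)) (fibre A B (idx (pfst (l - 1))) (pfst r))))" for r l
  show "computes_pred {} (\<lambda>z. R (pfst z) (psnd z))"
    unfolding R_def by (intro computes_intros computes_fibre_diagram A B computes_sort_encode[OF A])
  show "R r (list_encode us) \<longleftrightarrow> rel_of (parity_sum L A B b) r us"
    if r: "sum_lang L r = Some (RelSym (length us))" and us: "set us \<subseteq> universe (parity_sum L A B b)"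
    for r us
  proof -
    obtain u ws where us': "us = u # ws"
      using r by (cases us) (auto simp: sum_lang_def split: option.splits sym_sort.splits if_splits)
    have ws: "ws \<noteq> []" if "psnd r = 0"
      using r that by (auto simp: sum_lang_def us')
    have "psnd r = 0 \<Longrightarrow> pfst (list_encode ws - 1) = ws ! 0"
      using ws by (cases ws) auto
    then show ?thesis
      unfolding rel_of_parity_sum sum_rel_iff_atomic_diagram[OF r us] R_def
      unfolding us' list.sel list_encode_inverse
      by simp
  qed
qed

text \<open>\<open>U\<close> stands for the universe of \<open>A i\<close>, on which
  \<open>h\<close> is inverted. At the other coordinates the fibre is the same before and after the
  flip.\<close>

definition flip_map :: "nat set \<Rightarrow> nat \<Rightarrow> (nat \<Rightarrow> nat) \<Rightarrow> nat \<Rightarrow> nat" where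
  "flip_map U i h u = elt (flip i (idx u)) (crd u)
     (if crd u \<noteq> i then pnt u
      else if i \<in> set_decode (idx u) then inv_into U h (pnt u) else h (pnt u))"

lemma is_iso_flip_map:
  assumes A: "uniformly_computable UNIV L A" and B: "uniformly_computable UNIV L B"
    and h: "is_iso (L i) (A i) (B i) h"
  shows "is_iso (sum_lang L) (parity_sum L A B True) (parity_sum L A B False)
    (flip_map (universe (A i)) i h)"
proof -
  define g where "g c j = (if j \<noteq> i then (\<lambda>x. x)
      else if i \<in> set_decode c then inv_into (universe (A i)) h else h)" for c j
  have "is_iso (L j) (fibre A B c j) (fibre A B (flip i c) j) (g c j)" for c j
    using h is_iso_inv_into[OF h] is_struc_fibre[OF A B, of i 0]
    by (auto simp: g_def fibre_def mem_set_decode_flip is_iso_id)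
  from is_iso_parity_sum[OF this is_struc_fibre[OF A B], of True]
  have "is_iso (sum_lang L) (parity_sum L A B True) (parity_sum L A B False)
    (\<lambda>u. elt (flip i (idx u)) (crd u) (g (idx u) (crd u) (pnt u)))" by simp
  moreover have "(\<lambda>u. elt (flip i (idx u)) (crd u) (g (idx u) (crd u) (pnt u))) = flip_map (universe (A i)) i h"
    by (simp add: flip_map_def g_def fun_eq_iff)
  ultimately show ?thesis by simp
qed

section \<open>Turing reductions between graphs\<close>

lemma mem_graph_on: "z \<in> graph_on D h \<longleftrightarrow> pfst z \<in> D \<and> psnd z = h (pfst z)"
proof -
  have "z = prod_encode (a, h a) \<longleftrightarrow> pfst z = a \<and> psnd z = h a" for a
    by (metis fst_conv prod.collapse prod_decode_inverse prod_encode_inverse snd_conv)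
  then show ?thesis by (auto simp: graph_on_def)
qed

text \<open>The graph of the inverse is that of \<open>h\<close> with its pairs swapped, so one
  oracle for \<open>h\<close> decides both directions.\<close>

lemma turing_le_graph_flip_map:
  assumes A: "uniformly_computable UNIV L A" and B: "uniformly_computable UNIV L B"
    and h: "is_iso (L i) (A i) (B i) h"
    and X: "turing_le (graph_on (universe (A i)) h) X"
  shows "turing_le (graph_on (universe (parity_sum L A B True)) (flip_map (universe (A i)) i h)) X"
proof -
  let ?G = "graph_on (universe (A i)) h"
  have bij: "bij_betw h (universe (A i)) (universe (B i))" using h by (simp add: is_iso_def)
  have fwd: "prod_encode (x, y) \<in> ?G \<longleftrightarrow> y = h x" if "x \<in> universe (A i)" for x y
    using that by (simp add: mem_graph_on)
  have bwd: "prod_encode (y, x) \<in> ?G \<longleftrightarrow> y = inv_into (universe (A i)) h x" if "x \<in> universe (B i)" for x y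
    using bij that by (auto simp: mem_graph_on bij_betw_def inv_into_into f_inv_into_f)
  have elt_eq: "v = elt c j x \<longleftrightarrow> idx v = c \<and> crd v = j \<and> pnt v = x" for v c j x
    by (metis fst_conv prod.collapse prod_decode_inverse prod_encode_inverse snd_conv)
  have "z \<in> graph_on (universe (parity_sum L A B True)) (flip_map (universe (A i)) i h) \<longleftrightarrow>
      pfst z \<in> universe (parity_sum L A B True) \<and>
      idx (psnd z) = flip i (idx (pfst z)) \<and> crd (psnd z) = crd (pfst z) \<and>
      (if crd (pfst z) \<noteq> i then pnt (psnd z) = pnt (pfst z)
       else if i \<in> set_decode (idx (pfst z)) then prod_encode (pnt (psnd z), pnt (pfst z)) \<in> ?G
       else prod_encode (pnt (pfst z), pnt (psnd z)) \<in> ?G)" for z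
  proof (cases "pfst z \<in> universe (parity_sum L A B True)")
    case True
    then have "pnt (pfst z) \<in> universe (fibre A B (idx (pfst z)) (crd (pfst z)))"
      by (simp add: mem_universe_parity_sum)
    then show ?thesis
      unfolding mem_graph_on[of z] flip_map_def elt_eq
      by (cases "crd (pfst z) = i"; cases "i \<in> set_decode (idx (pfst z))")
        (auto simp: True fibre_def fwd bwd)
  next
    case False
    then show ?thesis by (simp add: mem_graph_on[of z])
  qed
  moreover have G: "computes_pred X (\<lambda>n. n \<in> ?G)" using X by (simp add: turing_le_iff_computes)
  ultimately show ?thesis
    unfolding turing_le_iff_computes
    by (simp only:) (intro computes_intros computes_universe_parity_sum[OF A B]
        computes_compose[OF G])
qed

text \<open>Since \<open>i\<close> and \<open>c\<close> are fixed numbers, sending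
  \<open>(x, y)\<close> to \<open>(elt 0 i x, elt c i y)\<close> is a computable reduction of one
  graph to the other.\<close>

lemma turing_le_graph_parity_sumD:
  assumes X: "turing_le (graph_on (universe (parity_sum L A B True)) F) X"
    and M: "\<And>x. x \<in> universe (A i) \<longleftrightarrow> elt 0 i x \<in> universe (parity_sum L A B True)"
    and F: "\<And>x. x \<in> universe (A i) \<Longrightarrow> F (elt 0 i x) = elt c i (h x)"
  shows "turing_le (graph_on (universe (A i)) h) X"
proof -
  let ?G = "graph_on (universe (parity_sum L A B True)) F"
  have "z \<in> graph_on (universe (A i)) h \<longleftrightarrow> prod_encode (elt 0 i (pfst z), elt c i (psnd z)) \<in> ?G" for z
    using M[of "pfst z"] F[of "pfst z"] by (auto simp: mem_graph_on)
  moreover have G: "computes_pred X (\<lambda>n. n \<in> ?G)" using X by (simp add: turing_le_iff_computes)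
  ultimately show ?thesis
    unfolding turing_le_iff_computes
    by (simp only:) (intro computes_compose[OF G] computes_intros)
qed

theorem theoremB:
  fixes L :: "nat \<Rightarrow> language" and A B :: "nat \<Rightarrow> struc"
  assumes "uniformly_computable UNIV L A"
    and "uniformly_computable UNIV L B"
    and "\<And>i. isomorphic (L i) (A i) (B i)"
  shows "\<exists>K M N. computable_struc K M \<and> computable_struc K N \<and> isomorphic K M N \<and>
           IsoSpec K M N = (\<Union>i. IsoSpec (L i) (A i) (B i))"
proof (intro exI conjI)
  let ?K = "sum_lang L" and ?M = "parity_sum L A B True" and ?N = "parity_sum L A B False"
  show "computable_struc ?K ?M" "computable_struc ?K ?N"
    by (rule computable_struc_parity_sum[OF assms(1,2)])+
  obtain h where "is_iso (L 0) (A 0) (B 0) h" using assms(3) by (auto simp: isomorphic_def)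
  from is_iso_flip_map[OF assms(1,2) this] show "isomorphic ?K ?M ?N"
    unfolding isomorphic_def by blast
  \<comment> \<open>A degree is a set of oracles, so it is enough to compare the two sides for each
    oracle \<open>X\<close> separately.\<close>
  have "(\<exists>F. is_iso ?K ?M ?N F \<and> turing_le (graph_on (universe ?M) F) X) \<longleftrightarrow>
      (\<exists>i h. is_iso (L i) (A i) (B i) h \<and> turing_le (graph_on (universe (A i)) h) X)" for X
  proof
    assume "\<exists>F. is_iso ?K ?M ?N F \<and> turing_le (graph_on (universe ?M) F) X"
    then obtain F where F: "is_iso ?K ?M ?N F" "turing_le (graph_on (universe ?M) F) X" by blast
    have "is_struc (L j) (A j)" for j
      using assms(1) by (simp add: uniformly_computable_def computable_struc_def)
    from is_iso_parity_sumD[OF F(1) this] obtain i c h where h: "is_iso (L i) (A i) (B i) h"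
      "\<And>x. x \<in> universe (A i) \<Longrightarrow> F (elt 0 i x) = elt c i (h x)" by metis
    have "x \<in> universe (A i) \<longleftrightarrow> elt 0 i x \<in> universe ?M" for x
      by (simp add: mem_universe_parity_sum fibre_def)
    from turing_le_graph_parity_sumD[OF F(2) this h(2)] h(1)
    show "\<exists>i h. is_iso (L i) (A i) (B i) h \<and> turing_le (graph_on (universe (A i)) h) X" by blast
  next
    assume "\<exists>i h. is_iso (L i) (A i) (B i) h \<and> turing_le (graph_on (universe (A i)) h) X"
    then obtain i h where h: "is_iso (L i) (A i) (B i) h"
      and X: "turing_le (graph_on (universe (A i)) h) X" by blast
    from is_iso_flip_map[OF assms(1,2) h] turing_le_graph_flip_map[OF assms(1,2) h X]
    show "\<exists>F. is_iso ?K ?M ?N F \<and> turing_le (graph_on (universe ?M) F) X" by blast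
  qed
  then show "IsoSpec ?K ?M ?N = (\<Union>i. IsoSpec (L i) (A i) (B i))"
    unfolding IsoSpec_def by blast
qed

end
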